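(* Let $X_1,\dots,X_k$ ($k\ge1$) be nonempty compact metric spaces. Every compact metric space $Y$ which can be equipped with a countably infinite family $\mathcal Y=\mathcal Y_1\sqcup\dots\sqcup\mathcal Y_k$ of subsets satisfying conditions (a1)–(a5) below is homeomorphic to the dense amalgam $\widetilde\sqcup(X_1,\dots,X_k)$: (a1) the members of $\mathcal Y$ are pairwise disjoint, and for each $i$ every member of $\mathcal Y_i$ is a subspace homeomorphic to $X_i$; (a2) $\mathcal Y$ is null: for any metric on $Y$ compatible with its topology, the diameters of the members of $\mathcal Y$ converge to $0$ (i.e. for every $\varepsilon>0$ only finitely many members have diameter $\ge\varepsilon$); (a3) each $Z\in\mathcal Y$ is a boundary subset of $Y$ (its complement is dense in $Y$); (a4) for each $i$, the union $\bigcup\mathcal Y_i$ is dense in $Y$; (a5) any two points of $Y$ which do not belong to the same member of $\mathcal Y$ can be separated by a subset $H\subset Y$ which is open, closed and $\mathcal Y$-saturated (every member of $\mathcal Y$ is either contained in $H$ or disjoint from $H$).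
   Context: Dense amalgam. Let $X$ be a nonempty compact metric space. A peripheral extension of $X$ is a compact metrizable space $\ddot X$ containing a countably infinite discrete subset $P$ which is open and dense in $\ddot X$, such that $\ddot X\setminus P$ is homeomorphic to $X$; it exists and is unique up to a homeomorphism that is the identity on $X$. Let $T$ be the countable tree in which every vertex has infinite valence, $V_T$ its vertex set, and for $t\in V_T$ let $N_t$ be the set of oriented edges $[t,s]$ of $T$ with initial vertex $t$. A complete tree system $\Theta$ of peripheral extensions of $X$ consists of, for each $t\in V_T$, a copy $X_t$ of $X$ with a peripheral extension $\ddot X_t$ and peripheral set $P_t=\ddot X_t\setminus X_t$, together with a bijection $b_t:N_t\to P_t$. For a finite subtree $F\subset T$ let $\vee_F\Theta$ be the quotient of $\bigsqcup_{t\in V_F}\ddot X_t$ by the identifications $b_t([t,s])\sim b_s([s,t])$ for all edges $[t,s]$ of $F$. For finite subtrees $F'\subset F$, let $\rho_{F,F'}:\vee_F\Theta\to\vee_{F'}\Theta$ be the identity on $\vee_{F'}\Theta$ and, for $s\in V_F\setminus V_{F'}$ and $x\in\ddot X_s$, $\rho_{F,F'}(x)=b_t([t,t'])$, where $t$ is the vertex of $F'$ nearest to $s$ and $t'$ is the vertex adjacent to $t$ on the geodesic from $t$ to $s$. The wedge $\vee\Theta$ is the inverse limit of the system $(\vee_F\Theta,\rho_{F,F'})$ over finite subtrees of $T$. Let $P_\Theta\subset\vee\Theta$ be the set of points represented by $b_t(e)$, $t\in V_T$, $e\in N_t$. The dense amalgam $\widetilde\sqcup(X)$ is $\vee\Theta\setminus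 P_\Theta$ (well defined up to homeomorphism). For nonempty compact metric spaces $X_1,\dots,X_k$, $\widetilde\sqcup(X_1,\dots,X_k):=\widetilde\sqcup(X_1\sqcup\dots\sqcup X_k)$. *)

theory Defs
  imports "HOL-Analysis.Analysis" "HOL-Library.Sublist"
begin

definition peripheral_extension :: "'a topology \<Rightarrow> 'b topology \<Rightarrow> 'b set \<Rightarrow> bool" where
  "peripheral_extension X Xdd P \<longleftrightarrow>
     compact_space Xdd \<and> metrizable_space Xdd \<and> P \<subseteq> topspace Xdd \<and>
     countable P \<and> infinite P \<and>
     (\<forall>p\<in>P. openin (subtopology Xdd P) {p}) \<and>
     openin Xdd P \<and> Xdd closure_of P = topspace Xdd \<and>
     subtopology Xdd (topspace Xdd - P) homeomorphic_space X"

section \<open>The tree T: vertices are finite lists of naturals, children of u are u@[n]\<close>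

definition tadj :: "nat list \<Rightarrow> nat list \<Rightarrow> bool" where
  "tadj u v \<longleftrightarrow> (\<exists>n. v = u @ [n]) \<or> (\<exists>n. u = v @ [n])"

definition nbrs :: "nat list \<Rightarrow> nat list set" where
  "nbrs t = {s. tadj t s}"

definition tdist :: "nat list \<Rightarrow> nat list \<Rightarrow> nat" where
  "tdist u v = length u + length v - 2 * length (longest_common_prefix u v)"

definition geod :: "nat list \<Rightarrow> nat list \<Rightarrow> nat list set" where
  "geod u v = {w. (prefix w u \<or> prefix w v) \<and> prefix (longest_common_prefix u v) w}"

text \<open>finite subtrees, identified with their (finite, nonempty, geodesically convex) vertex sets;
  their edges are all edges of T between their vertices\<close>
definition finite_subtree :: "nat list set \<Rightarrow> bool" where
  "finite_subtree F \<longleftrightarrow> finite F \<and> F \<noteq> {} \<and> (\<forall>u\<in>F. \<forall>v\<in>F. geod u v \<subseteq> F)"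

definition nearest :: "nat list set \<Rightarrow> nat list \<Rightarrow> nat list" where
  "nearest F s = (THE t. t \<in> F \<and> (\<forall>u\<in>F. u \<noteq> t \<longrightarrow> tdist t s < tdist u s))"

definition toward :: "nat list \<Rightarrow> nat list \<Rightarrow> nat list" where
  "toward t s = (THE w. tadj t w \<and> tdist w s < tdist t s)"

definition tree_system ::
  "'a topology \<Rightarrow> (nat list \<Rightarrow> 'b topology) \<Rightarrow> (nat list \<Rightarrow> 'b set) \<Rightarrow> (nat list \<Rightarrow> nat list \<Rightarrow> 'b) \<Rightarrow> bool" where
  "tree_system X Xdd P b \<longleftrightarrow>
     (\<forall>t. peripheral_extension X (Xdd t) (P t) \<and> bij_betw (b t) (nbrs t) (P t))"

definition quotient_topology :: "'a topology \<Rightarrow> ('a \<Rightarrow> 'c) \<Rightarrow> 'c topology" where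
  "quotient_topology X f =
     topology (\<lambda>U. U \<subseteq> f ` topspace X \<and> openin X {x \<in> topspace X. f x \<in> U})"

definition wcls :: "(nat list \<Rightarrow> 'b topology) \<Rightarrow> (nat list \<Rightarrow> nat list \<Rightarrow> 'b) \<Rightarrow> nat list set
     \<Rightarrow> nat list \<times> 'b \<Rightarrow> (nat list \<times> 'b) set" where
  "wcls Xdd b F p = {q \<in> topspace (sum_topology Xdd F). q = p \<or>
      (\<exists>t s. t \<in> F \<and> s \<in> F \<and> tadj t s \<and> p = (t, b t s) \<and> q = (s, b s t))}"

definition wedgeF :: "(nat list \<Rightarrow> 'b topology) \<Rightarrow> (nat list \<Rightarrow> nat list \<Rightarrow> 'b) \<Rightarrow> nat list set
     \<Rightarrow> (nat list \<times> 'b) set topology" where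
  "wedgeF Xdd b F = quotient_topology (sum_topology Xdd F) (wcls Xdd b F)"

definition rho_pt :: "(nat list \<Rightarrow> nat list \<Rightarrow> 'b) \<Rightarrow> nat list set \<Rightarrow> nat list \<times> 'b \<Rightarrow> nat list \<times> 'b" where
  "rho_pt b F' p = (if fst p \<in> F' then p
      else (let t = nearest F' (fst p) in (t, b t (toward t (fst p)))))"

text \<open>the bonding map rho_{F,F'} on points of the wedge over F (given by any representative)\<close>
definition rho :: "(nat list \<Rightarrow> 'b topology) \<Rightarrow> (nat list \<Rightarrow> nat list \<Rightarrow> 'b) \<Rightarrow> nat list set
     \<Rightarrow> (nat list \<times> 'b) set \<Rightarrow> (nat list \<times> 'b) set" where
  "rho Xdd b F' c = wcls Xdd b F' (rho_pt b F' (SOME p. p \<in> c))"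

definition subtrees :: "nat list set set" where
  "subtrees = {F. finite_subtree F}"

definition wedge :: "(nat list \<Rightarrow> 'b topology) \<Rightarrow> (nat list \<Rightarrow> nat list \<Rightarrow> 'b)
     \<Rightarrow> (nat list set \<Rightarrow> (nat list \<times> 'b) set) topology" where
  "wedge Xdd b = subtopology (product_topology (wedgeF Xdd b) subtrees)
     {c \<in> topspace (product_topology (wedgeF Xdd b) subtrees).
        \<forall>F\<in>subtrees. \<forall>F'\<in>subtrees. F' \<subseteq> F \<longrightarrow> rho Xdd b F' (c F) = c F'}"

definition periph_pts :: "(nat list \<Rightarrow> 'b topology) \<Rightarrow> (nat list \<Rightarrow> nat list \<Rightarrow> 'b)
     \<Rightarrow> (nat list set \<Rightarrow> (nat list \<times> 'b) set) set" where
  "periph_pts Xdd b = {c \<in> topspace (wedge Xdd b). \<exists>t s. tadj t s \<and>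
      (\<forall>F\<in>subtrees. t \<in> F \<longrightarrow> c F = wcls Xdd b F (t, b t s))}"

definition dense_amalgam_of :: "(nat list \<Rightarrow> 'b topology) \<Rightarrow> (nat list \<Rightarrow> nat list \<Rightarrow> 'b)
     \<Rightarrow> (nat list set \<Rightarrow> (nat list \<times> 'b) set) topology" where
  "dense_amalgam_of Xdd b = subtopology (wedge Xdd b) (topspace (wedge Xdd b) - periph_pts Xdd b)"

end

theory Submission
  imports Defs
begin

text \<open>
  Collapsing the members of the family turns \<open>Y\<close> into a zero-dimensional space, so \<open>Y\<close> can be cut
  into clopen sets that are saturated. Let \<open>H\<close> be such a set and let \<open>W\<close> be the union of \<open>k\<close> of its members,
  one of each type. By nullness, \<open>H - W\<close> splits into a sequence of clopen saturated pieces
  that become arbitrarily close to single points of \<open>W\<close>. Matching the pieces with peripheral points yields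
  a continuous map from \<open>H\<close> onto a given peripheral extension that is a homeomorphism from \<open>W\<close>
  onto the copy of \<open>X\<close> and whose fibres over the peripheral points are the pieces. Iterating inside the pieces
  along the tree \<open>T\<close> produces compatible maps from \<open>Y\<close> to all the extensions, hence a continuous map from
  the compact space \<open>Y\<close> to the Hausdorff dense amalgam. At depth \<open>n\<close> the construction uses up the \<open>n\<close>th
  member and refines the \<open>n\<close>th clopen saturated set, so that, by (a5), this map is injective;
  surjectivity is a compactness argument along a branch of \<open>T\<close>.
\<close>

section \<open>Projections in the tree\<close>

text \<open>The extensions are given in advance, so the pieces of \<open>H - W\<close> have to be
  matched with existing peripheral points. Every piece and every point must be used exactly once,
  and distances must tend to 0; this calls for a Schroeder-Bernstein argument that keeps track of
  each pair. At a vertex other than the root one peripheral point belongs to the edge to the parent.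
  It is deleted before the matching and afterwards receives everything outside \<open>H t\<close>.
  For this reason no point of \<open>Y\<close> is sent to a pair of peripheral points facing each
  other across an edge, that is, to \<open>periph_pts\<close>. Pieces are not made small along a
  branch. Two points that always share a piece cannot be separated by any listed clopen saturated
  set, so they share a member, and that member is embedded at its own depth. A point of the wedge is
  handled through its coordinates over one-vertex subtrees. That these determine it, and that the
  amalgam is therefore Hausdorff, comes out of the surjectivity argument.\<close>

lemma tadj_sym: "tadj u v \<longleftrightarrow> tadj v u"
  by (auto simp: tadj_def)

lemma tadj_irrefl [simp]: "\<not> tadj t t"
  by (auto simp: tadj_def)

lemma tadj_snoc [simp]: "tadj t (t @ [n])"
  by (auto simp: tadj_def)

lemma tadj_butlast: "t \<noteq> [] \<Longrightarrow> tadj t (butlast t)"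
  unfolding tadj_def by (metis append_butlast_last_id)

lemma tadj_cases:
  assumes "tadj t s"
  obtains n where "s = t @ [n]" | "t \<noteq> []" "s = butlast t"
  using assms by (auto simp: tadj_def)

lemma prefix_long_eq: "prefix u v \<Longrightarrow> length v \<le> length u \<Longrightarrow> u = v"
  by (auto simp: prefix_def)

lemma longest_common_prefix_eqI:
  assumes "prefix m u" "prefix m v" "\<And>w. prefix w u \<Longrightarrow> prefix w v \<Longrightarrow> prefix w m"
  shows "longest_common_prefix u v = m"
  by (meson assms longest_common_prefix_max_prefix longest_common_prefix_prefix1
      longest_common_prefix_prefix2 prefix_order.eq_iff)

lemma longest_common_prefix_commute: "longest_common_prefix u v = longest_common_prefix v u"
  by (meson longest_common_prefix_eqI longest_common_prefix_max_prefix longest_common_prefix_prefix1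
      longest_common_prefix_prefix2)

lemma longest_common_prefix_absorb: "prefix u v \<Longrightarrow> longest_common_prefix u v = u"
  by (rule longest_common_prefix_eqI) auto

text \<open>Prefixes of \<open>u\<close> are comparable, so a common prefix of \<open>u\<close> and
  \<open>s\<close> that is not a prefix of \<open>t\<close> would extend \<open>t\<close> and make
  \<open>t\<close> a prefix of \<open>s\<close>.\<close>

lemma longest_common_prefix_outside:
  assumes "prefix t u" "\<not> prefix t s"
  shows "longest_common_prefix u s = longest_common_prefix t s"
proof (rule longest_common_prefix_eqI)
  show "prefix (longest_common_prefix t s) u"
    using assms(1) longest_common_prefix_prefix1 prefix_order.trans by blast
  show "prefix (longest_common_prefix t s) s"
    by (rule longest_common_prefix_prefix2)
  fix w assume w: "prefix w u" "prefix w s"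
  then have "prefix w t"
    by (metis assms prefix_same_cases prefix_order.trans)
  then show "prefix w (longest_common_prefix t s)"
    using w(2) by (rule longest_common_prefix_max_prefix)
qed

lemma tdist_prefix: "prefix t s \<Longrightarrow> tdist t s = length s - length t"
  by (auto simp: tdist_def longest_common_prefix_absorb)

lemma tdist_snoc:
  assumes "\<not> prefix (t @ [n]) s"
  shows "tdist (t @ [n]) s = Suc (tdist t s)"
proof -
  have "longest_common_prefix (t @ [n]) s = longest_common_prefix t s"
  proof (rule longest_common_prefix_eqI)
    fix w assume "prefix w (t @ [n])" "prefix w s"
    with assms show "prefix w (longest_common_prefix t s)"
      by (auto intro: longest_common_prefix_max_prefix)
  qed (auto simp: longest_common_prefix_prefix2 longest_common_prefix_prefix1)
  moreover have "length (longest_common_prefix t s) \<le> length t" "length (longest_common_prefix t s) \<le> length s"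
    by (auto intro: prefix_length_le simp: longest_common_prefix_prefix1 longest_common_prefix_prefix2)
  ultimately show ?thesis
    by (simp add: tdist_def)
qed

lemma tdist_snoc_prefix:
  assumes "prefix (t @ [n]) s"
  shows "tdist t s = Suc (tdist (t @ [n]) s)"
  using assms prefix_length_le[OF assms]
  by (auto simp: tdist_prefix append_prefixD)

lemma toward_eqI:
  assumes "tadj t w" "tdist w s < tdist t s"
    and "\<And>v. tadj t v \<Longrightarrow> tdist v s < tdist t s \<Longrightarrow> v = w"
  shows "toward t s = w"
  unfolding toward_def by (rule the_equality) (use assms in blast)+

lemma toward_down:
  assumes "prefix (t @ [n]) s"
  shows "toward t s = t @ [n]"
proof (rule toward_eqI)
  show "tdist (t @ [n]) s < tdist t s"
    using tdist_snoc_prefix[OF assms] by simp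
next
  \<comment> \<open>Uniqueness for the \<open>THE\<close>: a child that does not lead to
    \<open>s\<close> is farther away, and so is the parent, because the step from it to
    \<open>t\<close> already heads for \<open>s\<close>.\<close>
  fix v assume v: "tadj t v" and d: "tdist v s < tdist t s"
  show "v = t @ [n]"
    using v
  proof (cases rule: tadj_cases)
    case (1 m)
    have "prefix v s"
      using tdist_snoc[of t m s] d 1 by (metis Suc_n_not_le_n less_or_eq_imp_le)
    then show ?thesis
      using assms 1 by (auto simp: prefix_def)
  next
    case 2
    then have "t = v @ [last t]" by simp
    moreover have "prefix (v @ [last t]) s"
      using assms calculation by (metis append_prefixD)
    ultimately show ?thesis
      using tdist_snoc_prefix[of v "last t" s] d by simp
  qed
qed simp

lemma toward_up:
  assumes "\<not> prefix t s"
  shows "toward t s = butlast t"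
proof -
  have ne: "t \<noteq> []" using assms by auto
  then have t: "t = butlast t @ [last t]" by simp
  show ?thesis
  proof (rule toward_eqI)
    show "tadj t (butlast t)" by (rule tadj_butlast[OF ne])
    show "tdist (butlast t) s < tdist t s"
      using tdist_snoc[of "butlast t" "last t" s] t assms by (metis lessI)
  next
    fix v assume v: "tadj t v" and d: "tdist v s < tdist t s"
    show "v = butlast t"
      using v
    proof (cases rule: tadj_cases)
      case (1 m)
      then have "\<not> prefix (t @ [m]) s" using assms append_prefixD by blast
      then show ?thesis using tdist_snoc[of t m s] d 1 by simp
    qed
  qed
qed

lemma prefix_snoc_obtain:
  assumes "prefix t s" "t \<noteq> s"
  obtains n where "prefix (t @ [n]) s"
  using assms by (metis append_one_prefix prefix_order.less_le prefix_length_less)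

lemma toward_props:
  assumes "t \<noteq> s"
  shows "tadj t (toward t s)" "tdist (toward t s) s < tdist t s"
proof -
  have "tadj t (toward t s) \<and> tdist (toward t s) s < tdist t s"
  proof (cases "prefix t s")
    case True
    then obtain n where n: "prefix (t @ [n]) s" using assms by (rule prefix_snoc_obtain)
    then show ?thesis using toward_down[OF n] tdist_snoc_prefix[OF n] by simp
  next
    case False
    then have ne: "t \<noteq> []" by auto
    have "tdist t s = Suc (tdist (butlast t) s)"
      using tdist_snoc[of "butlast t" "last t" s] ne False by simp
    then show ?thesis using toward_up[OF False] tadj_butlast[OF ne] by simp
  qed
  then show "tadj t (toward t s)" "tdist (toward t s) s < tdist t s" by auto
qed

lemma toward_adj:
  assumes "tadj t s"
  shows "toward t s = s"
  using assms
proof (cases rule: tadj_cases)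
  case 2
  then have "\<not> prefix t s" using prefix_length_le[of t s] by (cases t) auto
  then show ?thesis using toward_up 2 by simp
qed (simp add: toward_down)

lemma subtreesD:
  assumes "F \<in> subtrees"
  shows "finite F" "F \<noteq> {}" "u \<in> F \<Longrightarrow> v \<in> F \<Longrightarrow> geod u v \<subseteq> F"
  using assms by (auto simp: subtrees_def finite_subtree_def)

text \<open>The next vertex lies on the geodesic, so convexity of \<open>F\<close> applies. Thus a
  coordinate facing a vertex of \<open>F\<close> faces across an edge of \<open>F\<close>.\<close>

lemma toward_in_subtree:
  assumes "F \<in> subtrees" "t \<in> F" "s \<in> F" "t \<noteq> s"
  shows "toward t s \<in> F"
proof -
  have "toward t s \<in> geod t s"
  proof (cases "prefix t s")
    case True
    then obtain n where n: "prefix (t @ [n]) s" using assms(4) by (rule prefix_snoc_obtain)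
    then show ?thesis
      using True by (auto simp: toward_down geod_def longest_common_prefix_absorb)
  next
    case False
    then have ne: "t \<noteq> []" by auto
    have "prefix (longest_common_prefix t s) t" "longest_common_prefix t s \<noteq> t"
      using False by (metis longest_common_prefix_prefix1) (metis False longest_common_prefix_prefix2)
    then have "prefix (longest_common_prefix t s) (butlast t)"
      using ne by (metis append_butlast_last_id prefix_snoc)
    then show ?thesis
      using False by (auto simp: toward_up geod_def prefixeq_butlast)
  qed
  with subtreesD(3)[OF assms(1-3)] show ?thesis by auto
qed

lemma singleton_subtree [simp]: "{t} \<in> subtrees"
  by (auto simp: subtrees_def finite_subtree_def geod_def longest_common_prefix_absorb
      prefix_order.antisym)

lemma edge_subtree: "{t, t @ [n]} \<in> subtrees"
  by (auto simp: subtrees_def finite_subtree_def geod_def longest_common_prefix_absorb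
      longest_common_prefix_commute[of "t @ [n]" t] prefix_order.antisym)

text \<open>A shortest vertex \<open>r\<close> works: its longest common prefix with
  \<open>u\<close> lies on their geodesic, hence in \<open>F\<close>, and minimality forces it to be
  \<open>r\<close>.\<close>

lemma subtree_root:
  assumes "F \<in> subtrees"
  obtains r where "r \<in> F" "\<And>u. u \<in> F \<Longrightarrow> prefix r u"
proof -
  obtain r where r: "r \<in> F" "\<And>u. u \<in> F \<Longrightarrow> length r \<le> length u"
    using subtreesD(2)[OF assms] ex_has_least_nat[of "\<lambda>u. u \<in> F" _ length] by blast
  have "prefix r u" if u: "u \<in> F" for u
  proof -
    let ?m = "longest_common_prefix r u"
    have "?m \<in> geod r u"
      by (auto simp: geod_def longest_common_prefix_prefix1)
    then have "?m \<in> F" using subtreesD(3)[OF assms r(1) u] by auto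
    then have "length r \<le> length ?m" using r by auto
    then have "?m = r"
      using longest_common_prefix_prefix1[of r u] by (intro prefix_long_eq)
    then show ?thesis by (metis longest_common_prefix_prefix2)
  qed
  with r(1) that show thesis by blast
qed

text \<open>Justifies the \<open>THE\<close> in \<open>nearest\<close>. If the root of
  \<open>F\<close> is not a prefix of \<open>s\<close>, every path from \<open>F\<close> to
  \<open>s\<close> leaves through the root; otherwise the nearest vertex is the longest prefix of
  \<open>s\<close> that lies in \<open>F\<close>.\<close>

lemma nearest_props:
  assumes F: "F \<in> subtrees"
  shows "nearest F s \<in> F" "\<And>u. u \<in> F \<Longrightarrow> u \<noteq> nearest F s \<Longrightarrow> tdist (nearest F s) s < tdist u s"
proof -
  obtain r where r: "r \<in> F" "\<And>u. u \<in> F \<Longrightarrow> prefix r u"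
    using subtree_root[OF F] by blast
  have "\<exists>t\<in>F. \<forall>u\<in>F. u \<noteq> t \<longrightarrow> tdist t s < tdist u s"
  proof (cases "prefix r s")
    case False
    have "tdist r s < tdist u s" if "u \<in> F" "u \<noteq> r" for u
    proof -
      have p: "prefix r u" using r that by auto
      then have "length r < length u"
        using that by (metis prefix_length_less prefix_order.le_neq_trans)
      moreover have "length (longest_common_prefix r s) \<le> length r" "length (longest_common_prefix r s) \<le> length s"
        by (auto intro: prefix_length_le simp: longest_common_prefix_prefix1 longest_common_prefix_prefix2)
      ultimately show ?thesis
        using longest_common_prefix_outside[OF p False] by (simp add: tdist_def)
    qed
    with r(1) show ?thesis by blast
  next
    case True
    have "\<exists>t. (t \<in> F \<and> prefix t s) \<and> (\<forall>u. u \<in> F \<and> prefix u s \<longrightarrow> length u \<le> length t)"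
      using True r(1)
      by (intro ex_has_greatest_nat[where k = r and b = "Suc (length s)"])
        (auto simp: less_Suc_eq_le intro: prefix_length_le)
    then obtain t where t: "t \<in> F" "prefix t s"
      and tmax: "\<And>u. u \<in> F \<Longrightarrow> prefix u s \<Longrightarrow> length u \<le> length t"
      by blast
    have "tdist t s < tdist u s" if u: "u \<in> F" "u \<noteq> t" for u
    proof -
      let ?m = "longest_common_prefix u s"
      have m: "prefix ?m u" "prefix ?m s"
        by (auto simp: longest_common_prefix_prefix1 longest_common_prefix_prefix2)
      \<comment> \<open>A longer common prefix of \<open>u\<close> and \<open>s\<close> would lie on
        the geodesic from \<open>u\<close> to \<open>t\<close>, hence in \<open>F\<close>, against
        the choice of \<open>t\<close>.\<close>
      have le: "length ?m \<le> length t"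
      proof (rule ccontr)
        assume long: "\<not> ?thesis"
        then have tm: "prefix t ?m" using t m by (meson nat_le_linear prefix_length_prefix)
        then have "longest_common_prefix u t = t"
          using m longest_common_prefix_absorb longest_common_prefix_commute prefix_order.trans by metis
        then have "?m \<in> geod u t" using tm m by (auto simp: geod_def)
        then have "?m \<in> F" using subtreesD(3)[OF F u(1) t(1)] by auto
        then show False using tmax m long by auto
      qed
      \<comment> \<open>The goal amounts to \<open>2 * length ?m < length t + length u\<close>, so
        beyond the weak bounds one strict inequality is enough.\<close>
      have "length ?m < length t \<or> length ?m < length u"
      proof (rule ccontr)
        assume "\<not> ?thesis"
        then have "length u \<le> length ?m" "length t \<le> length ?m" by auto
        then have "?m = u" "?m = t"
          using prefix_long_eq[OF m(1)] prefix_long_eq[OF prefix_length_prefix[OF m(2) t(2) le]]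
          by auto
        then show False using u by simp
      qed
      moreover have "length ?m \<le> length u" "length ?m \<le> length s" "length t \<le> length s"
        using m t by (auto intro: prefix_length_le)
      ultimately show ?thesis
        unfolding tdist_prefix[OF t(2)] unfolding tdist_def using le by arith
    qed
    with t show ?thesis by blast
  qed
  then obtain t where t: "t \<in> F" "\<And>u. u \<in> F \<Longrightarrow> u \<noteq> t \<Longrightarrow> tdist t s < tdist u s" by blast
  have "nearest F s = t"
    unfolding nearest_def
  proof (rule the_equality)
    fix v assume "v \<in> F \<and> (\<forall>u\<in>F. u \<noteq> v \<longrightarrow> tdist v s < tdist u s)"
    then show "v = t" using t by (metis not_less_iff_gr_or_eq)
  qed (use t in auto)
  with t show "nearest F s \<in> F" "\<And>u. u \<in> F \<Longrightarrow> u \<noteq> nearest F s \<Longrightarrow> tdist (nearest F s) s < tdist u s"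
    by auto
qed

section \<open>Matchings and compact metrizable spaces\<close>

text \<open>A clopen set is compact, hence a finite union of basic sets, and the balls of radius
  \<open>1 / Suc n\<close> around finite nets form a countable base. This allows one clopen set to
  be treated at each depth of the tree.\<close>

lemma countable_clopen:
  assumes "compact_space Y" "metrizable_space Y"
  shows "countable {C. openin Y C \<and> closedin Y C}"
proof -
  obtain M d where M: "Metric_space M d" and Y: "Y = Metric_space.mtopology M d"
    using assms(2) unfolding metrizable_space_def by blast
  interpret Metric_space M d by fact
  have "mtotally_bounded M"
    using assms(1) Y compactin_imp_mtotally_bounded by (simp add: compact_space_def)
  then have "\<exists>K. finite K \<and> K \<subseteq> M \<and> M \<subseteq> (\<Union>x\<in>K. mball x (1 / Suc n))" for n
    unfolding mtotally_bounded_def by simp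
  then obtain K where K: "\<And>n. finite (K n)" "\<And>n. K n \<subseteq> M"
      "\<And>n. M \<subseteq> (\<Union>x\<in>K n. mball x (1 / Suc n))"
    by metis
  define B where "B = (\<Union>n. (\<lambda>x. mball x (1 / Suc n)) ` K n)"
  have "countable B"
    unfolding B_def by (intro countable_UN[OF countableI_type] countable_image countable_finite[OF K(1)])
  have "C \<in> Union ` {\<F>. finite \<F> \<and> \<F> \<subseteq> B}" if C: "openin Y C" "closedin Y C" for C
  proof -
    have "C \<subseteq> \<Union> {A \<in> B. A \<subseteq> C}"
    proof
      fix y assume y: "y \<in> C"
      then obtain r where r: "r > 0" "mball y r \<subseteq> C" and yM: "y \<in> M"
        using C(1) unfolding Y openin_mtopology by blast
      obtain n where n: "1 / Suc n < r / 2"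
        using r by (metis half_gt_zero inverse_eq_divide reals_Archimedean)
      obtain x where x: "x \<in> K n" "y \<in> mball x (1 / Suc n)"
        using K(3)[of n] yM by blast
      have "mball x (1 / Suc n) \<subseteq> mball y r"
      proof
        fix z assume z: "z \<in> mball x (1 / Suc n)"
        then have "d y z \<le> d x y + d x z"
          using x triangle'[of y x z] commute by (auto simp: in_mball)
        then show "z \<in> mball y r"
          using z x n by (auto simp: in_mball)
      qed
      then show "y \<in> \<Union> {A \<in> B. A \<subseteq> C}"
        using x r unfolding B_def by blast
    qed
    moreover have "compactin Y C"
      using assms(1) C(2) closedin_compact_space by blast
    moreover have "\<And>A. A \<in> {A \<in> B. A \<subseteq> C} \<Longrightarrow> openin Y A"
      unfolding B_def Y by auto
    ultimately obtain \<F> where "finite \<F>" "\<F> \<subseteq> {A \<in> B. A \<subseteq> C}" "C \<subseteq> \<Union>\<F>"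
      by (meson compactinD)
    then have "finite \<F>" "\<F> \<subseteq> B" "C = \<Union>\<F>" by auto
    then show ?thesis by blast
  qed
  then have "{C. openin Y C \<and> closedin Y C} \<subseteq> Union ` {\<F>. finite \<F> \<and> \<F> \<subseteq> B}"
    by blast
  then show ?thesis
    using countable_Collect_finite_subset[OF \<open>countable B\<close>] countable_image countable_subset by metis
qed

lemma infinite_inj_choice:
  fixes S :: "nat \<Rightarrow> nat set"
  assumes "\<And>n. infinite (S n)"
  shows "\<exists>r. inj r \<and> (\<forall>n. r n \<in> S n)"
proof -
  have "\<exists>r. \<forall>n. r n \<in> S n \<and> r n < r (Suc n)"
  proof (rule dependent_nat_choice)
    show "\<exists>x. x \<in> S 0" using assms by (metis ex_in_conv finite.emptyI)
    show "\<exists>y. y \<in> S (Suc n) \<and> x < y" for x n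
      using assms infinite_nat_iff_unbounded by blast
  qed
  then obtain r where r: "\<And>n. r n \<in> S n" "\<And>n. r n < r (Suc n)" by blast
  then have "strict_mono r" by (simp add: strict_mono_Suc_iff)
  then show ?thesis using r strict_mono_imp_inj_on by blast
qed

text \<open>The point is the second conjunct: every pair of the bijection comes from
  \<open>r\<close> or from \<open>s\<close>, so estimates known for the two injections carry over to
  it.\<close>

lemma Schroeder_Bernstein_graph:
  fixes r :: "'a \<Rightarrow> 'b" and s :: "'b \<Rightarrow> 'a"
  assumes "inj r" "inj s"
  shows "\<exists>f. bij f \<and> (\<forall>x. f x = r x \<or> x = s (f x))"
proof -
  \<comment> \<open>The points outside \<open>A\<close> are exactly the \<open>s\<close>-images of
    points not reached by \<open>r\<close> from \<open>A\<close>, so \<open>r\<close> on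
    \<open>A\<close> and the inverse of \<open>s\<close> elsewhere fit together.\<close>
  define A where "A = lfp (\<lambda>X. - (s ` (- (r ` X))))"
  have A: "A = - (s ` (- (r ` A)))"
    unfolding A_def by (rule lfp_unfold) (auto simp: mono_def)
  then have out: "x \<notin> A \<longleftrightarrow> (\<exists>y. x = s y \<and> y \<notin> r ` A)" for x
    by blast
  define f where "f x = (if x \<in> A then r x else inv s x)" for x
  have fs: "f (s y) = y" if "y \<notin> r ` A" for y
    using that out[of "s y"] assms(2) by (auto simp: f_def)
  have fA: "f x \<in> r ` A \<longleftrightarrow> x \<in> A" for x
  proof (cases "x \<in> A")
    case False
    then obtain y where "x = s y" "y \<notin> r ` A" using out by blast
    then show ?thesis using False fs[of y] by simp
  qed (simp add: f_def)
  have "inj f"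
  proof (rule injI)
    fix x y assume eq: "f x = f y"
    show "x = y"
    proof (cases "x \<in> A")
      case True
      then have "y \<in> A" using eq fA by metis
      then show ?thesis using True eq injD[OF assms(1)] by (simp add: f_def)
    next
      case False
      then have "y \<notin> A" using eq fA by metis
      then obtain u v where "x = s u" "u \<notin> r ` A" "y = s v" "v \<notin> r ` A"
        using False out by blast
      then show ?thesis using eq fs by simp
    qed
  qed
  moreover have "surj f"
    unfolding surj_def
  proof
    fix y
    show "\<exists>x. y = f x"
      using fs[of y] by (metis f_def imageE)
  qed
  moreover have "f x = r x \<or> x = s (f x)" for x
  proof (cases "x \<in> A")
    case False
    then obtain y where "x = s y" "y \<notin> r ` A" using out by blast
    then show ?thesis using fs by simp
  qed (simp add: f_def)
  ultimately show ?thesis unfolding bij_def by blast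
qed

text \<open>The asymmetry fits the use: \<open>m\<close> will index isolated points, which keep a
  positive distance from the targets indexed by \<open>n\<close>, so only a tolerance
  \<open>\<delta> m\<close> tending to 0 can be asked for them. Pairs from \<open>r\<close> are
  within \<open>1 / Suc n\<close>, pairs from \<open>s\<close> within \<open>\<delta> (f n)\<close>,
  and injectivity of \<open>f\<close> turns the latter into decay in \<open>n\<close>.\<close>

lemma bij_matching:
  fixes D :: "nat \<Rightarrow> nat \<Rightarrow> real" and \<delta> :: "nat \<Rightarrow> real"
  assumes "\<And>n \<epsilon>. \<epsilon> > 0 \<Longrightarrow> infinite {m. D n m < \<epsilon>}"
    and "\<And>m. infinite {n. D n m < \<delta> m}"
    and \<delta>: "\<And>\<epsilon>. \<epsilon> > 0 \<Longrightarrow> finite {m. \<delta> m \<ge> \<epsilon>}"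
  shows "\<exists>f. bij f \<and> (\<forall>\<epsilon>>0. finite {n. D n (f n) \<ge> \<epsilon>})"
proof -
  obtain r where r: "inj r" "\<And>n. D n (r n) < 1 / Suc n"
    using infinite_inj_choice[of "\<lambda>n. {m. D n m < 1 / Suc n}"] assms(1) by auto
  obtain s where s: "inj s" "\<And>m. D (s m) m < \<delta> m"
    using infinite_inj_choice[of "\<lambda>m. {n. D n m < \<delta> m}"] assms(2) by auto
  obtain f where f: "bij f" "\<And>n. f n = r n \<or> n = s (f n)"
    using Schroeder_Bernstein_graph[OF r(1) s(1)] by blast
  have "finite {n. D n (f n) \<ge> \<epsilon>}" if "\<epsilon> > 0" for \<epsilon>
  proof -
    obtain N where N: "1 / Suc N < \<epsilon>"
      using \<open>\<epsilon> > 0\<close> by (metis inverse_eq_divide reals_Archimedean)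
    have "n \<in> {..N} \<union> f -` {m. \<delta> m \<ge> \<epsilon>}" if n: "D n (f n) \<ge> \<epsilon>" for n
    proof (cases "f n = r n")
      case True
      then have "1 / Suc N < 1 / Suc n" using r(2)[of n] n N by simp
      then show ?thesis by (simp add: field_simps)
    next
      case False
      then show ?thesis using f(2)[of n] s(2)[of "f n"] n by auto
    qed
    moreover have "finite ({..N} \<union> f -` {m. \<delta> m \<ge> \<epsilon>})"
      using finite_vimageI[OF \<delta>[OF that] bij_is_inj[OF f(1)]] by simp
    ultimately show ?thesis by (metis (mono_tags, lifting) finite_subset mem_Collect_eq subsetI)
  qed
  with f(1) show ?thesis by blast
qed

lemma almost_minimizer:
  fixes f :: "'a \<Rightarrow> real"
  assumes "A \<noteq> {}" "\<And>a. a \<in> A \<Longrightarrow> 0 \<le> f a" "\<eta> > 0"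
  shows "\<exists>a\<in>A. \<forall>a'\<in>A. f a < f a' + \<eta>"
proof -
  have bdd: "bdd_below (f ` A)" using assms(2) by (auto simp: bdd_below_def)
  obtain a where a: "a \<in> A" "f a < Inf (f ` A) + \<eta>"
    using cInf_lessD[of "f ` A" "Inf (f ` A) + \<eta>"] assms by auto
  have "f a < f a' + \<eta>" if "a' \<in> A" for a'
    using cINF_lower[OF bdd that] a by simp
  with a show ?thesis by blast
qed

text \<open>Peripheral points are isolated, so deleting finitely many leaves a clopen subspace; its
  open sets are open in \<open>D\<close>, which preserves density. The point to be deleted is the
  one facing the parent.\<close>

lemma peripheral_extension_remove_finite:
  assumes "peripheral_extension X D P" "P' \<subseteq> P" "finite (P - P')"
  shows "peripheral_extension X (subtopology D (topspace D - (P - P'))) P'"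
proof -
  note P = assms(1)[unfolded peripheral_extension_def]
  let ?S = "topspace D - (P - P')"
  have op: "openin D {p}" if "p \<in> P" for p
    using P that by (metis openin_trans_full)
  have top: "topspace (subtopology D ?S) = ?S" by auto
  have "openin D (\<Union>p\<in>P - P'. {p})" by (rule openin_Union) (use op in auto)
  then have "openin D (P - P')" by simp
  then have clS: "closedin D ?S" by blast
  have P'S: "P' \<subseteq> ?S" using P assms(2) by auto
  have "openin D (\<Union>p\<in>P'. {p})" by (rule openin_Union) (use op assms(2) in auto)
  then have opP': "openin D P'" by simp
  have "closedin D (P - P')"
    using P assms(3) by (metis Diff_subset Hausdorff_imp_t1_space closedin_t1_singleton metrizable_imp_Hausdorff_space
      order.trans t1_space_closedin_finite)
  then have opS: "openin D ?S" by blast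
  have "subtopology D ?S closure_of P' = topspace (subtopology D ?S)"
    unfolding dense_intersects_open
  proof (intro allI impI)
    fix U assume U: "openin (subtopology D ?S) U \<and> U \<noteq> {}"
    then have "openin D U" using opS openin_trans_full by blast
    then have "U \<inter> P \<noteq> {}" using P U by (metis dense_intersects_open inf_commute)
    moreover have "U \<subseteq> ?S" using U openin_subset top by metis
    ultimately show "P' \<inter> U \<noteq> {}" by auto
  qed
  moreover have "subtopology (subtopology D ?S) (topspace (subtopology D ?S) - P') homeomorphic_space X"
  proof -
    have "?S \<inter> (?S - P') = topspace D - P" using assms(2) by auto
    then show ?thesis using P top by (simp add: subtopology_subtopology)
  qed
  moreover have "infinite P'" using P assms(2,3)
    by (metis Diff_infinite_finite double_diff dual_order.refl)
  moreover have "openin (subtopology (subtopology D ?S) P') {p}" if "p \<in> P'" for p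
  proof -
    have "openin D {p}" using op that assms(2) by auto
    then show ?thesis using that P'S by (auto simp: subtopology_subtopology openin_subtopology)
  qed
  moreover have "compact_space (subtopology D ?S)"
    using P clS closedin_compact_space compact_space_subtopology by blast
  moreover have "openin (subtopology D ?S) P'"
    using opP' P'S openin_open_subtopology opS by blast
  moreover have "countable P'" using countable_subset[OF assms(2)] P by simp
  moreover have "metrizable_space (subtopology D ?S)" 
    by (rule metrizable_space_subtopology) (use P in simp)
  ultimately show ?thesis
    using P'S unfolding peripheral_extension_def top by simp
qed

lemma metrizable_metric:
  assumes "metrizable_space Y"
  obtains d where "Metric_space (topspace Y) d" "Metric_space.mtopology (topspace Y) d = Y"
  using assms unfolding metrizable_space_def by (metis Metric_space.topspace_mtopology)

lemma compact_space_sum_topology: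
  assumes "finite I" "\<And>i. i \<in> I \<Longrightarrow> compact_space (X i)"
  shows "compact_space (sum_topology X I)"
proof -
  have "compactin (sum_topology X I) (\<Union>i\<in>I. (\<lambda>x. (i, x)) ` topspace (X i))"
    using assms
    by (intro compactin_Union)
      (auto intro!: image_compactin continuous_map_component_injection simp: compact_space_def[symmetric])
  moreover have "(\<Union>i\<in>I. (\<lambda>x. (i, x)) ` topspace (X i)) = topspace (sum_topology X I)"
    by auto
  ultimately show ?thesis by (simp add: compact_space_def)
qed

section \<open>Decomposing a space with a null family\<close>

locale null_partition =
  fixes X :: "nat \<Rightarrow> 'a topology" and k :: nat
    and Y :: "'y topology" and YF :: "nat \<Rightarrow> 'y set set"
  assumes k: "k \<ge> 1"
    and X: "\<forall>i<k. compact_space (X i) \<and> metrizable_space (X i) \<and> topspace (X i) \<noteq> {}"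
    and compact_Y: "compact_space Y" and metrizable_Y: "metrizable_space Y"
    and YF_disj: "\<forall>i<k. \<forall>j<k. i \<noteq> j \<longrightarrow> YF i \<inter> YF j = {}"
    and countable_members: "countable (\<Union>i<k. YF i)" and infinite_members: "infinite (\<Union>i<k. YF i)"
    and a1: "\<forall>Z\<in>(\<Union>i<k. YF i). \<forall>Z'\<in>(\<Union>i<k. YF i). Z \<noteq> Z' \<longrightarrow> Z \<inter> Z' = {}"
    and a1': "\<forall>i<k. \<forall>Z\<in>YF i. Z \<subseteq> topspace Y \<and> subtopology Y Z homeomorphic_space X i"
    and a2: "\<forall>d. Metric_space (topspace Y) d \<and> Metric_space.mtopology (topspace Y) d = Y \<longrightarrow>
               (\<forall>\<epsilon>>0. finite {Z \<in> (\<Union>i<k. YF i). Sup {d x y |x y. x \<in> Z \<and> y \<in> Z} \<ge> \<epsilon>})"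
    and a3: "\<forall>Z\<in>(\<Union>i<k. YF i). Y closure_of (topspace Y - Z) = topspace Y"
    and a4: "\<forall>i<k. Y closure_of (\<Union>(YF i)) = topspace Y"
    and a5: "\<forall>x\<in>topspace Y. \<forall>y\<in>topspace Y. x \<noteq> y \<and> \<not> (\<exists>Z\<in>(\<Union>i<k. YF i). x \<in> Z \<and> y \<in> Z) \<longrightarrow>
               (\<exists>H. openin Y H \<and> closedin Y H \<and> (\<forall>Z\<in>(\<Union>i<k. YF i). Z \<subseteq> H \<or> Z \<inter> H = {})
                    \<and> x \<in> H \<and> y \<notin> H)"
begin

section \<open>Clopen saturated sets\<close>

definition members :: "'y set set" where "members = (\<Union>i<k. YF i)"

definition clopen_sat :: "'y set \<Rightarrow> bool" where
  "clopen_sat H \<longleftrightarrow> openin Y H \<and> closedin Y H \<and> (\<forall>Z\<in>members. Z \<subseteq> H \<or> Z \<inter> H = {})"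

text \<open>The fibre through \<open>y\<close> of the map collapsing each member. The collapsed
  space is never formed; \<open>clopen_sat\<close> sets stand for its clopen sets.\<close>

definition blk :: "'y \<Rightarrow> 'y set" where
  "blk y = insert y (\<Union>{Z \<in> members. y \<in> Z})"

lemma Hausdorff_Y: "Hausdorff_space Y"
  using metrizable_Y by (rule metrizable_imp_Hausdorff_space)

lemma clopen_sat_topspace: "clopen_sat (topspace Y)"
  using a1' by (auto simp: clopen_sat_def members_def)

lemma clopen_sat_empty: "clopen_sat {}"
  by (simp add: clopen_sat_def)

lemma clopen_sat_Int: "clopen_sat A \<Longrightarrow> clopen_sat B \<Longrightarrow> clopen_sat (A \<inter> B)"
  by (simp add: clopen_sat_def openin_Int closedin_Int) blast

lemma clopen_sat_Un: "clopen_sat A \<Longrightarrow> clopen_sat B \<Longrightarrow> clopen_sat (A \<union> B)"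
  by (simp add: clopen_sat_def openin_Un closedin_Un) blast

lemma clopen_sat_Diff: "clopen_sat A \<Longrightarrow> clopen_sat B \<Longrightarrow> clopen_sat (A - B)"
  by (simp add: clopen_sat_def openin_diff closedin_diff) blast

lemma clopen_sat_Union: "finite \<F> \<Longrightarrow> (\<And>A. A \<in> \<F> \<Longrightarrow> clopen_sat A) \<Longrightarrow> clopen_sat (\<Union>\<F>)"
  by (induction rule: finite_induct) (auto intro: clopen_sat_Un clopen_sat_empty)

lemma clopen_sat_subset: "clopen_sat A \<Longrightarrow> A \<subseteq> topspace Y"
  using closedin_subset clopen_sat_def by blast

lemma clopen_satD: "clopen_sat A \<Longrightarrow> Z \<in> members \<Longrightarrow> z \<in> Z \<Longrightarrow> z \<in> A \<Longrightarrow> Z \<subseteq> A"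
  unfolding clopen_sat_def by blast

lemma member_subset: "Z \<in> members \<Longrightarrow> Z \<subseteq> topspace Y"
  using a1' by (auto simp: members_def)

lemma members_disjoint: "Z \<in> members \<Longrightarrow> Z' \<in> members \<Longrightarrow> z \<in> Z \<Longrightarrow> z \<in> Z' \<Longrightarrow> Z = Z'"
  using a1 unfolding members_def by blast

lemma member_nonempty:
  assumes "Z \<in> members" shows "Z \<noteq> {}"
proof
  assume "Z = {}"
  obtain i where i: "i < k" "Z \<in> YF i" using assms by (auto simp: members_def)
  then have "subtopology Y {} homeomorphic_space X i" using a1' \<open>Z = {}\<close> by blast
  then show False using X i(1) homeomorphic_empty_space by fastforce
qed

lemma member_closed:
  assumes "Z \<in> members" shows "closedin Y Z"
proof -
  obtain i where i: "i < k" "Z \<in> YF i" using assms by (auto simp: members_def)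
  then have "compact_space (subtopology Y Z)"
    using a1' X homeomorphic_compact_space by blast
  then have "compactin Y Z"
    using member_subset[OF assms] compactin_subspace by blast
  then show ?thesis using Hausdorff_Y compactin_imp_closedin by blast
qed

lemma blk_member: "Z \<in> members \<Longrightarrow> y \<in> Z \<Longrightarrow> blk y = Z"
  using members_disjoint unfolding blk_def by blast

lemma blk_clopen_sat: "clopen_sat A \<Longrightarrow> y \<in> A \<Longrightarrow> blk y \<subseteq> A"
  using clopen_satD unfolding blk_def by blast

lemma blk_subset: "y \<in> topspace Y \<Longrightarrow> blk y \<subseteq> topspace Y"
  using blk_clopen_sat clopen_sat_topspace by blast

lemma clopen_sat_separates:
  assumes "y \<in> topspace Y" "z \<in> topspace Y" "z \<notin> blk y"
  shows "\<exists>H. clopen_sat H \<and> y \<in> H \<and> z \<notin> H"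
proof -
  have "y \<noteq> z \<and> \<not> (\<exists>Z\<in>members. y \<in> Z \<and> z \<in> Z)"
    using assms(3) unfolding blk_def by blast
  then show ?thesis
    using a5[folded members_def, rule_format, OF assms(1,2)] by (simp add: clopen_sat_def conj_assoc)
qed

text \<open>Zero-dimensionality of the collapsed space. Points outside \<open>U\<close> are outside
  \<open>blk y\<close>, so (a5) separates them from \<open>y\<close>, and finitely many of the
  separating complements cover the compact set outside \<open>U\<close>.\<close>

lemma clopen_sat_nbhd:
  assumes y: "y \<in> topspace Y" and U: "openin Y U" "blk y \<subseteq> U"
  shows "\<exists>N. clopen_sat N \<and> y \<in> N \<and> N \<subseteq> U"
proof -
  define \<C> where "\<C> = {topspace Y - H | H. clopen_sat H \<and> y \<in> H}"
  have "topspace Y - U \<subseteq> \<Union>\<C>"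
  proof
    fix z assume z: "z \<in> topspace Y - U"
    then obtain H where "clopen_sat H" "y \<in> H" "z \<notin> H"
      using clopen_sat_separates[OF y] U(2) by blast
    then show "z \<in> \<Union>\<C>" using z unfolding \<C>_def by blast
  qed
  moreover have "compactin Y (topspace Y - U)"
    using compact_Y U(1) closedin_compact_space by blast
  moreover have sat: "clopen_sat A" if "A \<in> \<C>" for A
    using that clopen_sat_Diff clopen_sat_topspace unfolding \<C>_def by blast
  then have "\<And>A. A \<in> \<C> \<Longrightarrow> openin Y A" by (auto simp: clopen_sat_def)
  ultimately obtain \<F> where \<F>: "finite \<F>" "\<F> \<subseteq> \<C>" "topspace Y - U \<subseteq> \<Union>\<F>"
    by (meson compactinD)
  have "clopen_sat (topspace Y - \<Union>\<F>)"
    using \<F> sat by (intro clopen_sat_Diff clopen_sat_Union clopen_sat_topspace) auto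
  moreover have "y \<in> topspace Y - \<Union>\<F>" using \<F>(2) y unfolding \<C>_def by blast
  moreover have "topspace Y - \<Union>\<F> \<subseteq> U" using \<F>(3) by blast
  ultimately show ?thesis by blast
qed

lemma clopen_sat_nbhd_members:
  assumes "finite \<W>" "\<W> \<subseteq> members" "openin Y U" "\<Union>\<W> \<subseteq> U"
  shows "\<exists>N. clopen_sat N \<and> \<Union>\<W> \<subseteq> N \<and> N \<subseteq> U"
proof -
  have "\<exists>N. clopen_sat N \<and> Z \<subseteq> N \<and> N \<subseteq> U" if Z: "Z \<in> \<W>" for Z
  proof -
    obtain z where z: "z \<in> Z" using member_nonempty Z assms(2) by blast
    have "blk z = Z" using blk_member z Z assms(2) by blast
    then show ?thesis
      using clopen_sat_nbhd[of z U] clopen_satD[of _ Z z] member_subset[of Z] assms Z z by blast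
  qed
  then obtain N where N: "\<And>Z. Z \<in> \<W> \<Longrightarrow> clopen_sat (N Z) \<and> Z \<subseteq> N Z \<and> N Z \<subseteq> U"
    by metis
  have "clopen_sat (\<Union>(N ` \<W>))" using N assms(1) by (intro clopen_sat_Union) auto
  then show ?thesis using N by (intro exI[of _ "\<Union>(N ` \<W>)"]) blast
qed

text \<open>Members are closed and disjoint, so removing all but one of them from \<open>U\<close>
  leaves a nonempty open set inside a single member, against (a3). Later this makes the pieces
  infinite in number and accumulate at every point of \<open>W\<close>.\<close>

lemma no_open_in_finite_members:
  assumes "finite \<W>" "\<W> \<subseteq> members" "openin Y U" "U \<subseteq> \<Union>\<W>"
  shows "U = {}"
proof (rule ccontr)
  assume "U \<noteq> {}"
  then obtain w Z where w: "w \<in> U" "w \<in> Z" "Z \<in> \<W>" using assms(4) by blast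
  let ?V = "U - \<Union>(\<W> - {Z})"
  have "closedin Y (\<Union>(\<W> - {Z}))"
    using assms member_closed by (intro closedin_Union) auto
  then have V: "openin Y ?V" using assms(3) by blast
  have "w \<in> ?V" using w assms(2) members_disjoint by blast
  moreover have "?V \<subseteq> Z" using assms(4) by blast
  moreover have "Y closure_of (topspace Y - Z) = topspace Y"
    using a3 w assms(2) unfolding members_def by blast
  ultimately show False
    using V unfolding dense_intersects_open by blast
qed

lemma countable_clopen_sat: "countable {H. clopen_sat H}"
  by (rule countable_subset[OF _ countable_clopen[OF compact_Y metrizable_Y]])
    (auto simp: clopen_sat_def)

text \<open>Density (a4) gives a point, saturation the whole member. Hence every nonempty piece
  contains all \<open>k\<close> types again and the construction can be repeated inside it.\<close>

lemma clopen_sat_contains_member: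
  assumes "clopen_sat H" "H \<noteq> {}" "i < k"
  shows "\<exists>Z\<in>YF i. Z \<subseteq> H"
proof -
  have "\<Union>(YF i) \<inter> H \<noteq> {}"
    using a4 assms unfolding dense_intersects_open clopen_sat_def by blast
  then obtain Z z where "Z \<in> YF i" "z \<in> Z" "z \<in> H" by blast
  moreover then have "Z \<in> members" using assms(3) by (auto simp: members_def)
  ultimately show ?thesis using clopen_satD[OF assms(1)] by blast
qed

text \<open>\<open>Sup\<close> dominates the individual distances only when these are bounded above;
  compactness of \<open>Y\<close> supplies the bound.\<close>

lemma finite_large_members:
  assumes "Metric_space (topspace Y) d" "Metric_space.mtopology (topspace Y) d = Y" "\<epsilon> > 0"
  shows "finite {Z \<in> members. \<exists>x\<in>Z. \<exists>y\<in>Z. d x y \<ge> \<epsilon>}"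
proof -
  interpret Metric_space "topspace Y" d by fact
  have "mbounded (topspace Y)"
    using compact_Y assms(2) compactin_imp_mbounded by (simp add: compact_space_def)
  then obtain B where B: "\<And>x y. x \<in> topspace Y \<Longrightarrow> y \<in> topspace Y \<Longrightarrow> d x y \<le> B"
    unfolding mbounded_alt by blast
  have "{Z \<in> members. \<exists>x\<in>Z. \<exists>y\<in>Z. d x y \<ge> \<epsilon>} \<subseteq>
      {Z \<in> members. Sup {d x y |x y. x \<in> Z \<and> y \<in> Z} \<ge> \<epsilon>}"
  proof clarify
    fix Z x y assume Z: "Z \<in> members" "x \<in> Z" "y \<in> Z" "\<epsilon> \<le> d x y"
    have "bdd_above {d x y |x y. x \<in> Z \<and> y \<in> Z}"
      using B member_subset[OF Z(1)] by (intro bdd_aboveI[of _ B]) blast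
    then have "d x y \<le> Sup {d x y |x y. x \<in> Z \<and> y \<in> Z}"
      using Z by (intro cSup_upper) auto
    then show "\<epsilon> \<le> Sup {d x y |x y. x \<in> Z \<and> y \<in> Z}" using Z by simp
  qed
  moreover have "finite {Z \<in> members. Sup {d x y |x y. x \<in> Z \<and> y \<in> Z} \<ge> \<epsilon>}"
    using a2 assms unfolding members_def by blast
  ultimately show ?thesis by (rule finite_subset)
qed

text \<open>Away from \<open>W\<close>, compactness limits the number of pieces. Near
  \<open>W\<close>, a piece stays close to one class \<open>blk y\<close>, and this class is small:
  only finitely many members disjoint from \<open>W\<close> are large, and being closed they keep
  away from \<open>W\<close>.\<close>

lemma clopen_sat_pieces:
  assumes d: "Metric_space (topspace Y) d" "Metric_space.mtopology (topspace Y) d = Y"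
    and H: "clopen_sat H" and E: "clopen_sat E"
    and \<W>: "finite \<W>" "\<W> \<subseteq> members" "\<W> \<noteq> {}" and WH: "\<Union>\<W> \<subseteq> H"
  shows "\<exists>L::nat \<Rightarrow> 'y set. (\<forall>n. clopen_sat (L n) \<and> L n \<noteq> {} \<and> (L n \<subseteq> E \<or> L n \<inter> E = {})) \<and>
      disjoint_family L \<and> (\<Union>n. L n) = H - \<Union>\<W> \<and>
      (\<forall>\<epsilon>>0. finite {n. \<not> (\<exists>w\<in>\<Union>\<W>. L n \<subseteq> Metric_space.mball (topspace Y) d w \<epsilon>)})"
proof -
  interpret Metric_space "topspace Y" d by fact
  define W where "W = \<Union>\<W>"
  have clW: "closedin Y W"
    unfolding W_def using \<W> member_closed by (intro closedin_Union) auto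
  have W_ne: "W \<noteq> {}" using \<W> member_nonempty unfolding W_def by fastforce
  have WH: "W \<subseteq> H" using WH W_def by simp
  have H_top: "H \<subseteq> topspace Y" using H clopen_sat_subset by blast
  \<comment> \<open>Otherwise \<open>W\<close> would be open. Used twice: there is something to
    cover, and finitely many pieces cannot cover it.\<close>
  have HW_ne: "\<not> closedin Y (H - W)"
  proof
    assume "closedin Y (H - W)"
    then have "openin Y (H - (H - W))"
      using H by (intro openin_diff) (auto simp: clopen_sat_def)
    moreover have "H - (H - W) = W" using WH by blast
    ultimately show False
      using no_open_in_finite_members[OF \<W>(1,2), of W] W_ne W_def by simp
  qed
  obtain C :: "nat \<Rightarrow> 'y set" where C: "range C = {A. clopen_sat A}"
    using countable_clopen_sat clopen_sat_empty uncountable_def by (metis empty_iff mem_Collect_eq)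
  \<comment> \<open>The sets \<open>N j\<close> form a neighbourhood base of \<open>W\<close> in \<open>H\<close>; the pieces are cut from
    the layers \<open>N j - N (Suc j)\<close>, with precision \<open>1 / Suc j\<close>.\<close>
  define N where "N = rec_nat H (\<lambda>j A. if W \<subseteq> C j then A \<inter> C j else A)"
  have N0 [simp]: "N 0 = H" and NS: "N (Suc j) = (if W \<subseteq> C j then N j \<inter> C j else N j)" for j
    by (auto simp: N_def)
  have csN: "clopen_sat (N j)" for j
  proof (induction j)
    case (Suc j)
    have "clopen_sat (C j)" using C by blast
    then show ?case using Suc by (simp add: NS clopen_sat_Int)
  qed (simp add: H)
  have WN: "W \<subseteq> N j" for j
    by (induction j) (simp_all add: NS WH)
  have antimono: "N j \<subseteq> N i" if "i \<le> j" for i j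
    using that by (rule lift_Suc_antimono_le[rotated]) (auto simp: NS)
  have NU: "\<exists>j. N j \<subseteq> U" if U: "openin Y U" "W \<subseteq> U" for U
  proof -
    obtain A where A: "clopen_sat A" "W \<subseteq> A" "A \<subseteq> U"
      using clopen_sat_nbhd_members[OF \<W>(1,2) U(1)] U(2) W_def by auto
    then obtain j where "A = C j" using C by blast
    then have "N (Suc j) \<subseteq> U" using A by (auto simp: NS)
    then show ?thesis by blast
  qed
  \<comment> \<open>\<open>A\<close> lies in one layer, does not cut \<open>E\<close> and is thin
    around one class. Disjointing may later remove \<open>y\<close> from the piece, but the estimate
    through \<open>y\<close> survives for subsets of \<open>A\<close>.\<close>
  define good where "good A j y \<longleftrightarrow> clopen_sat A \<and> (A \<subseteq> E \<or> A \<inter> E = {}) \<and> y \<in> A \<and>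
      A \<subseteq> N j - N (Suc j) \<and> A \<subseteq> (\<Union>x\<in>blk y. mball x (1 / Suc j))" for A j y
  define G where "G = {A. \<exists>j y. good A j y}"
  have cover: "\<exists>A\<in>G. y \<in> A" if y: "y \<in> H - W" for y
  proof -
    have yY: "y \<in> topspace Y" using y H_top by blast
    have "openin Y (topspace Y - {y})"
      using yY Hausdorff_Y by (simp add: openin_diff closedin_Hausdorff_singleton)
    then obtain i where "N i \<subseteq> topspace Y - {y}"
      using NU[of "topspace Y - {y}"] y closedin_subset[OF clW] by blast
    then have ex: "\<exists>i. y \<notin> N i" by blast
    define i where "i = (LEAST i. y \<notin> N i)"
    have i: "y \<notin> N i" unfolding i_def using ex by (rule LeastI_ex)
    then have "i \<noteq> 0" using y by (metis DiffD1 N0)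
    then obtain j where j: "i = Suc j" using not0_implies_Suc by blast
    have yj: "y \<in> N j" using not_less_Least[of j "\<lambda>i. y \<notin> N i"] j i_def by auto
    have "openin Y (\<Union>x\<in>blk y. mball x (1 / Suc j))"
      using d(2) openin_mball by (intro openin_Union) (metis imageE)
    moreover have "blk y \<subseteq> (\<Union>x\<in>blk y. mball x (1 / Suc j))"
    proof
      fix x assume "x \<in> blk y"
      moreover then have "x \<in> mball x (1 / Suc j)" using blk_subset[OF yY] by auto
      ultimately show "x \<in> (\<Union>x\<in>blk y. mball x (1 / Suc j))" by blast
    qed
    ultimately obtain A where A: "clopen_sat A" "y \<in> A" "A \<subseteq> (\<Union>x\<in>blk y. mball x (1 / Suc j))"
      using clopen_sat_nbhd[OF yY] by blast
    define A' where "A' = A \<inter> (N j - N (Suc j)) \<inter> (if y \<in> E then E else topspace Y - E)"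
    have "clopen_sat A'" unfolding A'_def
      using A(1) csN E by (simp add: clopen_sat_Int clopen_sat_Diff clopen_sat_topspace)
    moreover have "y \<in> A'" unfolding A'_def using A yj i j yY by auto
    moreover have "A' \<subseteq> E \<or> A' \<inter> E = {}" unfolding A'_def by auto
    moreover have "A' \<subseteq> N j - N (Suc j)" "A' \<subseteq> A" unfolding A'_def by auto
    ultimately have "good A' j y" unfolding good_def using A(3) by auto
    then show ?thesis using \<open>y \<in> A'\<close> unfolding G_def by blast
  qed
  have G_ne: "G \<noteq> {}" using cover HW_ne by (metis closedin_empty ex_in_conv)
  have "countable G"
    by (rule countable_subset[OF _ countable_clopen_sat]) (auto simp: G_def good_def)
  then obtain g :: "nat \<Rightarrow> 'y set" where g: "range g = G"
    using G_ne uncountable_def by metis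
  have gG: "g n \<in> G" for n using g by blast
  define L where "L = disjointed g"
  have Lg: "L n \<subseteq> g n" for n unfolding L_def by (rule disjointed_subset)
  have Ldisj: "disjoint_family L" unfolding L_def by (rule disjoint_family_disjointed)
  have cs_g: "clopen_sat (g n)" for n using gG[of n] by (auto simp: G_def good_def)
  have cs_L: "clopen_sat (L n)" for n
    unfolding L_def disjointed_def using cs_g by (intro clopen_sat_Diff clopen_sat_Union) auto
  have g_HW: "g n \<subseteq> H - W" for n
  proof -
    obtain j y where "good (g n) j y" using gG[of n] by (auto simp: G_def)
    then show ?thesis using WN[of "Suc j"] antimono[of 0 j] by (auto simp: good_def)
  qed
  have L_Un: "(\<Union>n. L n) = H - W"
  proof -
    have "(\<Union>n. L n) = (\<Union>n. g n)" unfolding L_def by (rule UN_disjointed_eq)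
    also have "\<dots> = H - W" using g_HW cover g by (auto; blast)
    finally show ?thesis .
  qed
  \<comment> \<open>Disjoint open pieces cover the compact set \<open>H - N J\<close>, so every
    piece meeting it must occur in a finite subcover.\<close>
  have fin_off: "finite {n. \<not> L n \<subseteq> N J}" for J
  proof -
    have "compactin Y (H - N J)"
      using compact_Y clopen_sat_Diff[OF H csN] by (auto simp: clopen_sat_def intro: closedin_compact_space)
    moreover have "H - N J \<subseteq> \<Union>(range L)" using L_Un WN[of J] by blast
    moreover have "\<And>A. A \<in> range L \<Longrightarrow> openin Y A" using cs_L by (auto simp: clopen_sat_def)
    ultimately obtain \<F> where \<F>: "finite \<F>" "\<F> \<subseteq> range L" "H - N J \<subseteq> \<Union>\<F>"
      by (meson compactinD)
    then obtain I where I: "finite I" "\<F> = L ` I" by (meson finite_subset_image)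
    have "n \<in> I" if n: "\<not> L n \<subseteq> N J" for n
    proof -
      obtain z where z: "z \<in> L n" "z \<notin> N J" using n by blast
      then have "z \<in> H - N J" using L_Un by blast
      then obtain m where "m \<in> I" "z \<in> L m" using \<F>(3) I(2) by blast
      then show ?thesis using z(1) Ldisj by (metis disjoint_family_onD disjoint_iff UNIV_I)
    qed
    then show ?thesis using I(1) by (metis (mono_tags, lifting) finite_subset mem_Collect_eq subsetI)
  qed
  have fin_ball: "finite {n. L n \<noteq> {} \<and> \<not> (\<exists>w\<in>W. L n \<subseteq> mball w \<epsilon>)}" if \<epsilon>: "\<epsilon> > 0" for \<epsilon>
  proof -
    have "openin Y (\<Union>w\<in>W. mball w (\<epsilon>/3))"
      using d(2) openin_mball by (intro openin_Union) (metis imageE)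
    moreover have "W \<subseteq> (\<Union>w\<in>W. mball w (\<epsilon>/3))"
    proof
      fix x assume "x \<in> W"
      moreover then have "x \<in> mball x (\<epsilon>/3)" using closedin_subset[OF clW] \<epsilon> by auto
      ultimately show "x \<in> (\<Union>w\<in>W. mball w (\<epsilon>/3))" by blast
    qed
    ultimately obtain J1 where J1: "N J1 \<subseteq> (\<Union>w\<in>W. mball w (\<epsilon>/3))" using NU by blast
    \<comment> \<open>The classes that could be too wide: finitely many closed sets off
      \<open>W\<close>, so some \<open>N J2\<close> avoids them all.\<close>
    define \<B> where "\<B> = {Z \<in> members. Z \<inter> W = {} \<and> (\<exists>x\<in>Z. \<exists>y\<in>Z. d x y \<ge> \<epsilon>/3)}"
    have "finite \<B>"
      unfolding \<B>_def
      by (rule finite_subset[OF _ finite_large_members[OF d, of "\<epsilon>/3"]]) (use \<epsilon> in auto)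
    then have "closedin Y (\<Union>\<B>)"
      using member_closed by (intro closedin_Union) (auto simp: \<B>_def)
    then have "openin Y (topspace Y - \<Union>\<B>)" by blast
    moreover have "W \<subseteq> topspace Y - \<Union>\<B>" using closedin_subset[OF clW] by (auto simp: \<B>_def)
    ultimately obtain J2 where J2: "N J2 \<subseteq> topspace Y - \<Union>\<B>" using NU by blast
    obtain J3 where J3: "1 / Suc J3 < \<epsilon>/3"
      using \<epsilon> by (metis inverse_eq_divide reals_Archimedean zero_less_divide_iff zero_less_numeral)
    define J where "J = max J1 (max J2 J3)"
    have "\<exists>w\<in>W. L n \<subseteq> mball w \<epsilon>" if n: "L n \<subseteq> N J" "L n \<noteq> {}" for n
    proof -
      \<comment> \<open>A piece inside \<open>N J\<close> comes from a layer of index at least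
        \<open>J\<close>, so its \<open>y\<close> lies in \<open>N J1\<close> and
        \<open>N J2\<close> and its thickness is below \<open>\<epsilon>/3\<close>. The three thirds
        lead from \<open>w\<close> to \<open>y\<close>, from \<open>y\<close> to \<open>x\<close>
        within a class, and from \<open>x\<close> to \<open>z\<close>.\<close>
      obtain j y where gd: "good (g n) j y" using gG[of n] by (auto simp: G_def)
      obtain z0 where z0: "z0 \<in> L n" using n(2) by blast
      then have "z0 \<in> N J" "z0 \<notin> N (Suc j)" using n(1) Lg gd by (auto simp: good_def)
      then have "\<not> Suc j \<le> J" using antimono by blast
      then have jJ: "J \<le> j" by simp
      have "y \<in> N j" "y \<notin> N (Suc j)" using gd by (auto simp: good_def)
      then have yN: "y \<in> N J1" "y \<in> N J2" and yW: "y \<notin> W"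
        using antimono[of J1 j] antimono[of J2 j] jJ WN[of "Suc j"] by (auto simp: J_def)
      obtain w where w: "w \<in> W" "y \<in> mball w (\<epsilon>/3)" using J1 yN by blast
      have "L n \<subseteq> mball w \<epsilon>"
      proof
        fix z assume "z \<in> L n"
        then have "z \<in> (\<Union>x\<in>blk y. mball x (1 / Suc j))" using Lg gd unfolding good_def by blast
        then obtain x where x: "x \<in> blk y" "z \<in> mball x (1 / Suc j)" by blast
        have "1 / Suc j \<le> 1 / Suc J3"
          using jJ by (auto simp: J_def field_simps)
        then have xz: "d x z < \<epsilon>/3" using x J3 by auto
        have yx: "d y x < \<epsilon>/3"
        proof (cases "x = y")
          case True
          then show ?thesis using \<epsilon> w by auto
        next
          case False
          then obtain Z where Z: "Z \<in> members" "y \<in> Z" "x \<in> Z"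
            using x(1) unfolding blk_def by blast
          then have "Z \<inter> W = {}"
            using members_disjoint yW \<W>(2) unfolding W_def by blast
          moreover have "Z \<notin> \<B>" using J2 yN Z by blast
          ultimately show ?thesis using Z unfolding \<B>_def by (auto simp: not_le)
        qed
        have "d w z \<le> d w y + d y x + d x z"
          using triangle[of w y z] triangle[of y x z] w x by auto
        then show "z \<in> mball w \<epsilon>" using xz yx w x by auto
      qed
      then show ?thesis using w by blast
    qed
    then have "{n. L n \<noteq> {} \<and> \<not> (\<exists>w\<in>W. L n \<subseteq> mball w \<epsilon>)} \<subseteq> {n. \<not> L n \<subseteq> N J}" by blast
    then show ?thesis using fin_off finite_subset by blast
  qed
  \<comment> \<open>Disjointing can produce empty sets, which cannot serve as fibres over peripheral
    points; the nonempty ones are renumbered.\<close>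
  define I where "I = {n. L n \<noteq> {}}"
  have "infinite I"
  proof
    assume "finite I"
    then have "closedin Y (\<Union>(L ` I))"
      using cs_L by (intro closedin_Union) (auto simp: clopen_sat_def)
    moreover have "\<Union>(L ` I) = (\<Union>n. L n)" unfolding I_def by auto
    ultimately show False using HW_ne L_Un by simp
  qed
  define e where "e = enumerate I"
  have e: "bij_betw e UNIV I" unfolding e_def by (rule bij_enumerate) fact
  then have inj_e: "inj e" by (rule bij_betw_imp_inj_on)
  have eI: "e n \<in> I" for n using e by (auto simp: bij_betw_def)
  have refine: "L n \<subseteq> E \<or> L n \<inter> E = {}" for n
    using gG[of n] Lg[of n] unfolding G_def good_def by blast
  have "disjoint_family (\<lambda>n. L (e n))"
    using Ldisj inj_e unfolding disjoint_family_on_def by (metis UNIV_I injD)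
  moreover have "(\<Union>n. L (e n)) = H - W"
  proof -
    have "(\<Union>n. L (e n)) = \<Union>(L ` I)" using e by (auto simp: bij_betw_def)
    also have "\<dots> = (\<Union>n. L n)" unfolding I_def by auto
    finally show ?thesis using L_Un by simp
  qed
  moreover have "finite {n. \<not> (\<exists>w\<in>W. L (e n) \<subseteq> mball w \<epsilon>)}" if "\<epsilon> > 0" for \<epsilon>
  proof -
    have "{n. \<not> (\<exists>w\<in>W. L (e n) \<subseteq> mball w \<epsilon>)} \<subseteq> e -` {n. L n \<noteq> {} \<and> \<not> (\<exists>w\<in>W. L n \<subseteq> mball w \<epsilon>)}"
      using eI by (auto simp: I_def)
    then show ?thesis using finite_vimageI[OF fin_ball[OF that] inj_e] finite_subset by blast
  qed
  moreover have "L (e n) \<noteq> {}" for n using eI by (simp add: I_def)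
  ultimately show ?thesis
    using cs_L refine unfolding W_def by (intro exI[of _ "\<lambda>n. L (e n)"]) simp
qed

text \<open>The \<open>k\<close> homeomorphisms glue to a continuous bijection from a compact space
  to a Hausdorff one. Summands do not collide because members are disjoint and no member has two
  types.\<close>

lemma union_homeomorphic_sum:
  assumes Zs: "\<And>i. i < k \<Longrightarrow> Zs i \<in> YF i"
  shows "sum_topology X {..<k} homeomorphic_space subtopology Y (\<Union>i<k. Zs i)"
proof -
  have sub: "Zs i \<subseteq> topspace Y" if "i < k" for i using a1' Zs that by blast
  have "\<exists>f. homeomorphic_map (X i) (subtopology Y (Zs i)) f" if "i < k" for i
    using a1' Zs that homeomorphic_space homeomorphic_space_sym by blast
  then obtain f where f: "\<And>i. i < k \<Longrightarrow> homeomorphic_map (X i) (subtopology Y (Zs i)) (f i)"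
    by metis
  have fim: "f i ` topspace (X i) = Zs i" if "i < k" for i
    using homeomorphic_imp_surjective_map[OF f[OF that]] sub[OF that] by auto
  define \<phi> where "\<phi> = (\<lambda>p. f (fst p) (snd p))"
  have "continuous_map (sum_topology X {..<k}) Y \<phi>"
    unfolding continuous_map_def
  proof (intro conjI allI impI)
    have "f i x \<in> topspace Y" if "i < k" "x \<in> topspace (X i)" for i x
      using fim[OF that(1)] sub[OF that(1)] that(2) by blast
    then show "\<phi> \<in> topspace (sum_topology X {..<k}) \<rightarrow> topspace Y"
      by (auto simp: \<phi>_def)
    fix U assume U: "openin Y U"
    show "openin (sum_topology X {..<k}) {x \<in> topspace (sum_topology X {..<k}). \<phi> x \<in> U}"
      unfolding openin_sum_topology
    proof (intro conjI ballI)
      fix i assume i: "i \<in> {..<k}"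
      have "continuous_map (X i) Y (f i)"
        using f i homeomorphic_imp_continuous_map continuous_map_in_subtopology by blast
      then have "openin (X i) {x \<in> topspace (X i). f i x \<in> U}"
        using U openin_continuous_map_preimage by blast
      then show "openin (X i) {x. (i, x) \<in> {x \<in> topspace (sum_topology X {..<k}). \<phi> x \<in> U}}"
        using i by (simp add: \<phi>_def)
    qed auto
  qed
  moreover have im: "\<phi> ` topspace (sum_topology X {..<k}) = (\<Union>i<k. Zs i)"
  proof -
    have "\<phi> ` topspace (sum_topology X {..<k}) = (\<Union>i<k. f i ` topspace (X i))"
      unfolding \<phi>_def by force
    also have "\<dots> = (\<Union>i<k. Zs i)" using fim by (intro SUP_cong) auto
    finally show ?thesis .
  qed
  ultimately have "continuous_map (sum_topology X {..<k}) (subtopology Y (\<Union>i<k. Zs i)) \<phi>"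
    by (intro continuous_map_into_subtopology) auto
  moreover have "inj_on \<phi> (topspace (sum_topology X {..<k}))"
  proof (rule inj_onI)
    fix p p' assume p: "p \<in> topspace (sum_topology X {..<k})" "p' \<in> topspace (sum_topology X {..<k})"
      and eq: "\<phi> p = \<phi> p'"
    obtain i x where i: "p = (i, x)" "i < k" "x \<in> topspace (X i)" using p(1) by auto
    obtain j y where j: "p' = (j, y)" "j < k" "y \<in> topspace (X j)" using p(2) by auto
    have e: "f i x = f j y" using eq i j by (simp add: \<phi>_def)
    have "f i x \<in> Zs i" using fim[OF i(2)] i(3) by blast
    moreover have "f i x \<in> Zs j" using fim[OF j(2)] j(3) e by auto
    moreover have "Zs i \<in> members" "Zs j \<in> members" using Zs i j by (auto simp: members_def)
    ultimately have "Zs i = Zs j" using members_disjoint by blast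
    then have "i = j" using YF_disj Zs i j by (metis disjoint_iff)
    moreover have "inj_on (f i) (topspace (X i))"
      using f i homeomorphic_imp_injective_map by blast
    ultimately show "p = p'" using e i j by (auto dest: inj_onD)
  qed
  moreover have "compact_space (sum_topology X {..<k})"
    using X by (intro compact_space_sum_topology) auto
  moreover have "Hausdorff_space (subtopology Y (\<Union>i<k. Zs i))"
    using Hausdorff_Y Hausdorff_space_subtopology by blast
  moreover have "\<phi> ` topspace (sum_topology X {..<k}) = topspace (subtopology Y (\<Union>i<k. Zs i))"
    using im sub by (auto simp del: topspace_sum_topology)
  ultimately show ?thesis
    using continuous_imp_homeomorphic_map homeomorphic_map_imp_homeomorphic_space by blast
qed

text \<open>\<open>q\<close> is a homeomorphism \<open>g\<close> on \<open>W\<close> and sends each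
  piece to its matched peripheral point. It is continuous at \<open>W\<close> because pieces
  approach points \<open>w n\<close> while their peripheral points approach \<open>g (w n)\<close>.
  \<open>Z0\<close> is the member to be used up, \<open>E\<close> the set to be refined.\<close>

lemma peripheral_quotient:
  assumes P: "peripheral_extension (sum_topology X {..<k}) D P"
    and H: "clopen_sat H" "H \<noteq> {}" and E: "clopen_sat E"
  shows "\<exists>q. continuous_map (subtopology Y H) D q \<and> q ` H = topspace D \<and>
      inj_on q {y \<in> H. q y \<notin> P} \<and>
      (\<forall>p\<in>P. clopen_sat {y \<in> H. q y = p} \<and> ({y \<in> H. q y = p} \<subseteq> E \<or> {y \<in> H. q y = p} \<inter> E = {})) \<and>
      (Z0 \<in> members \<and> Z0 \<subseteq> H \<longrightarrow> q ` Z0 \<inter> P = {})"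
proof -
  note P' = P[unfolded peripheral_extension_def]
  have PD: "P \<subseteq> topspace D" "countable P" "infinite P" "openin D P" "compact_space D"
      "D closure_of P = topspace D" "metrizable_space D"
    using P' by auto
  have opP: "openin D {p}" if "p \<in> P" for p
    using P' that by (metis openin_trans_full)
  obtain d where d: "Metric_space (topspace Y) d" "Metric_space.mtopology (topspace Y) d = Y"
    using metrizable_metric[OF metrizable_Y] by blast
  obtain e where e: "Metric_space (topspace D) e" "Metric_space.mtopology (topspace D) e = D"
    using metrizable_metric[OF PD(7)] by blast
  interpret Y: Metric_space "topspace Y" d by fact
  interpret D: Metric_space "topspace D" e by fact
  have H_top: "H \<subseteq> topspace Y" using H clopen_sat_subset by blast
  \<comment> \<open>One member of each type, with \<open>Z0\<close> preferred for its own type if it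
    lies in \<open>H\<close>.\<close>
  have "\<exists>Z\<in>YF i. Z \<subseteq> H \<and> (Z0 \<in> YF i \<and> Z0 \<subseteq> H \<longrightarrow> Z = Z0)" if "i < k" for i
    using clopen_sat_contains_member[OF H that] by blast
  then obtain Zs where Zs: "\<And>i. i < k \<Longrightarrow> Zs i \<in> YF i" "\<And>i. i < k \<Longrightarrow> Zs i \<subseteq> H"
      "\<And>i. i < k \<Longrightarrow> Z0 \<in> YF i \<Longrightarrow> Z0 \<subseteq> H \<Longrightarrow> Zs i = Z0"
    by metis
  define \<W> where "\<W> = Zs ` {..<k}"
  define W where "W = \<Union>\<W>"
  have \<W>: "finite \<W>" "\<W> \<subseteq> members" "\<W> \<noteq> {}"
    using Zs k by (auto simp: \<W>_def members_def lessThan_empty_iff)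
  have WH: "\<Union>\<W> \<subseteq> H" using Zs by (auto simp: \<W>_def)
  then have W_sub: "W \<subseteq> H" "W \<subseteq> topspace Y" using H_top by (auto simp: W_def)
  have W_ne: "W \<noteq> {}" using \<W> member_nonempty unfolding W_def by fastforce
  have "sum_topology X {..<k} homeomorphic_space subtopology Y W"
    using union_homeomorphic_sum[OF Zs(1)] by (simp add: W_def \<W>_def)
  then have "subtopology Y W homeomorphic_space subtopology D (topspace D - P)"
    using P' homeomorphic_space_sym homeomorphic_space_trans by blast
  then obtain g where g: "homeomorphic_map (subtopology Y W) (subtopology D (topspace D - P)) g"
    using homeomorphic_space by blast
  have g_im: "g ` W = topspace D - P"
    using homeomorphic_imp_surjective_map[OF g] W_sub by (simp add: Int_absorb1)
  have g_inj: "inj_on g W"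
    using homeomorphic_imp_injective_map[OF g] W_sub by (simp add: Int_absorb1)
  have "continuous_map (subtopology Y W) D.mtopology g"
    using homeomorphic_imp_continuous_map[OF g] continuous_map_in_subtopology e(2) by auto
  have g_cont: "\<exists>\<delta>>0. \<forall>v\<in>W. d w v < \<delta> \<longrightarrow> e (g w) (g v) < \<epsilon>" if w: "w \<in> W" and \<epsilon>: "\<epsilon> > 0" for w \<epsilon>
  proof -
    obtain U where U: "openin (subtopology Y W) U" "w \<in> U" "\<forall>y\<in>U. g y \<in> D.mball (g w) \<epsilon>"
      using \<open>continuous_map (subtopology Y W) D.mtopology g\<close>[unfolded D.continuous_map_to_metric,
          rule_format, of w \<epsilon>] w \<epsilon> W_sub by (metis Int_absorb1 topspace_subtopology)
    obtain T where T: "openin Y T" "U = T \<inter> W" using U(1) by (auto simp: openin_subtopology)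
    then obtain r where r: "r > 0" "Y.mball w r \<subseteq> T"
      using U(2) Y.openin_mtopology[of T] d(2) by auto
    have "e (g w) (g v) < \<epsilon>" if v: "v \<in> W" "d w v < r" for v
    proof -
      have "v \<in> U" using T r v w W_sub by (auto simp: subset_iff)
      then show ?thesis using U(3) by auto
    qed
    then show ?thesis using r(1) by blast
  qed
  obtain L where csL: "\<And>n. clopen_sat (L n)" and L_ne: "\<And>n. L n \<noteq> {}"
    and refine: "\<And>n. L n \<subseteq> E \<or> L n \<inter> E = {}" and Ldisj: "disjoint_family L"
    and L_Un: "(\<Union>n::nat. L n) = H - W"
    and L_fin: "\<And>\<epsilon>. \<epsilon> > 0 \<Longrightarrow> finite {n. \<not> (\<exists>w\<in>W. L n \<subseteq> Y.mball w \<epsilon>)}"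
    using clopen_sat_pieces[OF d H(1) E \<W> WH] unfolding W_def by blast
  define l where "l n = (SOME y. y \<in> L n)" for n
  have l: "l n \<in> L n" for n using L_ne[of n] by (simp add: l_def some_in_eq)
  have L_top: "L n \<subseteq> topspace Y" for n using csL clopen_sat_subset by blast
  \<comment> \<open>\<open>L_fin\<close> offers a point of \<open>W\<close> depending on
    \<open>\<epsilon>\<close>; a nearly closest point to the sample \<open>l n\<close> serves all
    \<open>\<epsilon>\<close> at once, since the error \<open>1 / Suc n\<close> vanishes.\<close>
  have "\<exists>w\<in>W. \<forall>w'\<in>W. d (l n) w < d (l n) w' + 1 / Suc n" for n
    by (rule almost_minimizer) (use W_ne in auto)
  then obtain w where w: "\<And>n. w n \<in> W" "\<And>n w'. w' \<in> W \<Longrightarrow> d (l n) (w n) < d (l n) w' + 1 / Suc n"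
    by metis
  have near: "finite {n. \<not> L n \<subseteq> Y.mball (w n) \<epsilon>}" if \<epsilon>: "\<epsilon> > 0" for \<epsilon>
  proof -
    obtain N where N: "1 / Suc N < \<epsilon> / 4"
      using \<epsilon> by (metis inverse_eq_divide reals_Archimedean zero_less_divide_iff zero_less_numeral)
    have "L n \<subseteq> Y.mball (w n) \<epsilon>" if nN: "N \<le> n" and v: "v \<in> W" "L n \<subseteq> Y.mball v (\<epsilon>/4)" for n v
    proof
      fix z assume z: "z \<in> L n"
      have "1 / Suc n \<le> 1 / Suc N" using nN by (simp add: field_simps)
      moreover have "l n \<in> Y.mball v (\<epsilon>/4)" "z \<in> Y.mball v (\<epsilon>/4)"
        using l[of n] v(2) z by blast+
      moreover have wn: "w n \<in> topspace Y" using w W_sub by blast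
      ultimately show "z \<in> Y.mball (w n) \<epsilon>"
        using w(2)[OF v(1), of n] N Y.triangle[of "w n" "l n" z] Y.triangle[of "l n" v z]
          Y.commute[of "w n" "l n"] Y.commute[of "l n" v] by auto
    qed
    then have "n \<in> {..<N} \<union> {n. \<not> (\<exists>w\<in>W. L n \<subseteq> Y.mball w (\<epsilon>/4))}" if "\<not> L n \<subseteq> Y.mball (w n) \<epsilon>" for n
      using that not_le by blast
    moreover have "finite ({..<N} \<union> {n. \<not> (\<exists>w\<in>W. L n \<subseteq> Y.mball w (\<epsilon>/4))})"
      using L_fin[of "\<epsilon>/4"] \<epsilon> by simp
    ultimately show ?thesis by (metis (mono_tags, lifting) finite_subset mem_Collect_eq subsetI)
  qed
  \<comment> \<open>If only finitely many \<open>w n\<close> were near \<open>v\<close>, removing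
    their pieces and the finitely many wide ones from a ball at \<open>v\<close> would leave an open
    set inside \<open>W\<close>.\<close>
  have dense_w: "infinite {n. d (w n) v < \<epsilon>}" if v: "v \<in> W" and \<epsilon>: "\<epsilon> > 0" for v \<epsilon>
  proof
    assume fin: "finite {n. d (w n) v < \<epsilon>}"
    define B where "B = {n. d (w n) v < \<epsilon>} \<union> {n. \<not> L n \<subseteq> Y.mball (w n) (\<epsilon>/2)}"
    define U where "U = (Y.mball v (\<epsilon>/2) \<inter> H) - \<Union>(L ` B)"
    have "finite B" unfolding B_def using fin near[of "\<epsilon>/2"] \<epsilon> by simp
    then have "closedin Y (\<Union>(L ` B))"
      using csL by (intro closedin_Union) (auto simp: clopen_sat_def)
    moreover have "openin Y (Y.mball v (\<epsilon>/2) \<inter> H)"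
      using H d(2) Y.openin_mball[of v "\<epsilon>/2"] by (intro openin_Int) (auto simp: clopen_sat_def)
    ultimately have opU: "openin Y U" unfolding U_def by (rule openin_diff[rotated])
    have vU: "v \<in> U"
      unfolding U_def using v W_sub \<epsilon> L_Un by auto
    have "U \<subseteq> W"
    proof
      fix y assume y: "y \<in> U"
      show "y \<in> W"
      proof (rule ccontr)
        assume "y \<notin> W"
        then obtain n where n: "y \<in> L n" using y L_Un unfolding U_def by blast
        then have "n \<notin> B" using y unfolding U_def by blast
        then have "y \<in> Y.mball (w n) (\<epsilon>/2)" "\<not> d (w n) v < \<epsilon>" using n unfolding B_def by auto
        moreover have "d v y < \<epsilon>/2" using y unfolding U_def by auto
        moreover have "v \<in> topspace Y" using v W_sub by blast
        ultimately show False using Y.triangle[of "w n" y v] by (auto simp: Y.commute)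
      qed
    qed
    then show False
      using no_open_in_finite_members[OF \<W>(1,2) opU] vU unfolding W_def by blast
  qed
  obtain p where p: "bij_betw p (UNIV::nat set) P"
    using PD(2,3) bij_betw_from_nat_into by blast
  have pP: "p m \<in> P" for m using p by (auto simp: bij_betw_def)
  have inj_p: "inj p" using p by (auto simp: bij_betw_def)
  have gW: "g v \<in> topspace D - P" if "v \<in> W" for v using g_im that by blast
  have pD: "p m \<in> topspace D" for m using pP PD(1) by blast
  have "\<exists>x\<in>topspace D - P. \<forall>x'\<in>topspace D - P. e (p m) x < e (p m) x' + 1 / Suc m" for m
    by (rule almost_minimizer) (use g_im W_ne in auto)
  then obtain x where x: "\<And>m. x m \<in> topspace D - P"
      "\<And>m x'. x' \<in> topspace D - P \<Longrightarrow> e (p m) (x m) < e (p m) x' + 1 / Suc m"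
    by metis
  \<comment> \<open>The points of \<open>D\<close> at distance at least \<open>\<epsilon>/3\<close>
    from the copy of the sum space form a compact set of isolated points, hence a finite one;
    elsewhere the tolerance is below \<open>\<epsilon>/3 + 2 / Suc m\<close>.\<close>
  have far: "finite {m. e (p m) (x m) + 1 / Suc m \<ge> \<epsilon>}" if \<epsilon>: "\<epsilon> > 0" for \<epsilon>
  proof -
    obtain N where N: "1 / Suc N < \<epsilon> / 3"
      using \<epsilon> by (metis inverse_eq_divide reals_Archimedean zero_less_divide_iff zero_less_numeral)
    define K where "K = topspace D - (\<Union>x'\<in>topspace D - P. D.mball x' (\<epsilon>/3))"
    have "openin D (\<Union>x'\<in>topspace D - P. D.mball x' (\<epsilon>/3))"
      using e(2) D.openin_mball by (intro openin_Union) (metis imageE)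
    then have "compactin D K" unfolding K_def using PD(5) closedin_compact_space by blast
    moreover have "K \<subseteq> \<Union>((\<lambda>p. {p}) ` P)"
      using \<epsilon> by (auto simp: K_def)
    moreover have "\<And>A. A \<in> (\<lambda>p. {p}) ` P \<Longrightarrow> openin D A" using opP by auto
    ultimately obtain \<F> where \<F>: "finite \<F>" "\<F> \<subseteq> (\<lambda>p. {p}) ` P" "K \<subseteq> \<Union>\<F>"
      by (meson compactinD)
    have "finite K"
      by (rule finite_subset[OF \<F>(3)]) (use \<F>(1,2) in auto)
    have "m \<in> {..<N} \<union> p -` K" if m: "e (p m) (x m) + 1 / Suc m \<ge> \<epsilon>" for m
    proof (rule ccontr)
      assume "m \<notin> {..<N} \<union> p -` K"
      then have mN: "N \<le> m" and "p m \<notin> K" by auto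
      then obtain x' where x': "x' \<in> topspace D - P" "p m \<in> D.mball x' (\<epsilon>/3)"
        using pD unfolding K_def by blast
      have "1 / Suc m \<le> 1 / Suc N" using mN by (simp add: field_simps)
      moreover have "e (p m) x' < \<epsilon>/3" using x'(2) by (auto simp: D.commute)
      ultimately show False using m N x(2)[OF x'(1), of m] by linarith
    qed
    moreover have "finite ({..<N} \<union> p -` K)" using \<open>finite K\<close> inj_p by (simp add: finite_vimageI)
    ultimately show ?thesis by (metis (mono_tags, lifting) finite_subset mem_Collect_eq subsetI)
  qed
  have match1: "infinite {m. e (g (w n)) (p m) < \<epsilon>}" if \<epsilon>: "\<epsilon> > 0" for n \<epsilon>
  proof
    assume fin: "finite {m. e (g (w n)) (p m) < \<epsilon>}"
    define U where "U = D.mball (g (w n)) \<epsilon> - p ` {m. e (g (w n)) (p m) < \<epsilon>}"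
    have "closedin D (p ` {m. e (g (w n)) (p m) < \<epsilon>})"
      using fin pD PD(7) by (intro closedin_Hausdorff_finite) (auto intro: metrizable_imp_Hausdorff_space)
    moreover have "openin D (D.mball (g (w n)) \<epsilon>)" using e(2) D.openin_mball[of "g (w n)" \<epsilon>] by simp
    ultimately have "openin D U" unfolding U_def by (rule openin_diff[rotated])
    moreover have "g (w n) \<in> U" unfolding U_def using gW[OF w(1), of n] \<epsilon> pP by auto
    ultimately have "P \<inter> U \<noteq> {}" using PD(6) unfolding dense_intersects_open by blast
    then obtain m where "p m \<in> U" using p unfolding bij_betw_def by (metis disjoint_iff imageE)
    then show False unfolding U_def by auto
  qed
  \<comment> \<open>With \<open>x m = g v\<close>, the points \<open>w n\<close> return to
    \<open>v\<close> infinitely often, and the slack \<open>1 / Suc m\<close> absorbs the error from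
    the continuity of \<open>g\<close>.\<close>
  have match2: "infinite {n. e (g (w n)) (p m) < e (p m) (x m) + 1 / Suc m}" for m
  proof -
    obtain v where v: "v \<in> W" "x m = g v" using x(1)[of m] g_im by auto
    obtain \<delta> where \<delta>: "\<delta> > 0" "\<And>v'. v' \<in> W \<Longrightarrow> d v v' < \<delta> \<Longrightarrow> e (g v) (g v') < 1 / Suc m"
      using g_cont[OF v(1), of "1 / Suc m"] by auto
    have "{n. d (w n) v < \<delta>} \<subseteq> {n. e (g (w n)) (p m) < e (p m) (x m) + 1 / Suc m}"
    proof clarify
      fix n assume "d (w n) v < \<delta>"
      then have "e (g v) (g (w n)) < 1 / Suc m" using \<delta>(2)[OF w(1), of n] by (simp add: Y.commute)
      moreover have "e (g (w n)) (p m) \<le> e (g v) (g (w n)) + e (p m) (g v)"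
        using D.triangle[of "g (w n)" "g v" "p m"] gW[OF w(1)] gW[OF v(1)] pD by (simp add: D.commute)
      ultimately show "e (g (w n)) (p m) < e (p m) (x m) + 1 / Suc m" using v(2) by simp
    qed
    then show ?thesis using dense_w[OF v(1) \<delta>(1)] finite_subset by blast
  qed
  obtain f where f: "bij f" "\<And>\<epsilon>. \<epsilon> > 0 \<Longrightarrow> finite {n. e (g (w n)) (p (f n)) \<ge> \<epsilon>}"
    using bij_matching[of "\<lambda>n m. e (g (w n)) (p m)", OF match1 match2 far] by blast
  define c where "c = p \<circ> f"
  have c: "bij_betw c UNIV P" unfolding c_def using f(1) p by (rule bij_betw_trans)
  have cP: "c n \<in> P" for n using c by (auto simp: bij_betw_def)
  define q where "q y = (if y \<in> W then g y else c (THE n. y \<in> L n))" for y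
  have qW: "q y = g y" if "y \<in> W" for y using that by (simp add: q_def)
  have qL: "q y = c n" if y: "y \<in> L n" for y n
  proof -
    have "y \<notin> W" using y L_Un by blast
    moreover have "(THE n. y \<in> L n) = n"
      using y Ldisj by (intro the_equality) (auto simp: disjoint_family_on_def)
    ultimately show ?thesis by (simp add: q_def)
  qed
  have H_cases: "y \<in> W \<or> (\<exists>n. y \<in> L n)" if "y \<in> H" for y using that L_Un by blast
  have L_H: "L n \<subseteq> H" for n using L_Un by blast
  have q_fibre: "{y \<in> H. q y = c n} = L n" for n
  proof
    show "{y \<in> H. q y = c n} \<subseteq> L n"
    proof clarify
      fix y assume y: "y \<in> H" "q y = c n"
      then have "y \<notin> W" using qW gW cP by fastforce
      then obtain m where m: "y \<in> L m" using H_cases y by blast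
      then have "m = n" using qL[OF m] y(2) c by (auto simp: bij_betw_def dest: injD)
      then show "y \<in> L n" using m by simp
    qed
  qed (use qL L_H in auto)
  have "continuous_map (subtopology Y H) D.mtopology q"
    unfolding D.continuous_map_to_metric
  proof (intro ballI allI impI)
    fix y \<epsilon> assume y: "y \<in> topspace (subtopology Y H)" and \<epsilon>: "\<epsilon> > (0::real)"
    then have yH: "y \<in> H" by simp
    show "\<exists>U. openin (subtopology Y H) U \<and> y \<in> U \<and> (\<forall>z\<in>U. q z \<in> D.mball (q y) \<epsilon>)"
    proof (cases "y \<in> W")
      case False
      then obtain n where n: "y \<in> L n" using H_cases yH by blast
      have "openin (subtopology Y H) (L n)"
        using csL L_H H(1) by (simp add: clopen_sat_def openin_open_subtopology)
      moreover have "q z \<in> D.mball (q y) \<epsilon>" if "z \<in> L n" for z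
        using qL[OF n] qL[OF that] cP[of n] PD(1) \<epsilon> by auto
      ultimately show ?thesis using n by blast
    next
      case True
      obtain \<delta> where \<delta>: "\<delta> > 0" "\<And>v. v \<in> W \<Longrightarrow> d y v < \<delta> \<Longrightarrow> e (g y) (g v) < \<epsilon>/2"
        using g_cont[OF True, of "\<epsilon>/2"] \<epsilon> by auto
      \<comment> \<open>Only finitely many pieces are too wide or imprecisely matched. For
        \<open>z\<close> in any other piece, \<open>w n\<close> is within \<open>\<delta>\<close> of
        \<open>y\<close>, so \<open>g (w n)\<close> is close to both \<open>g y\<close> and
        \<open>c n\<close>.\<close>
      define B where "B = {n. e (g (w n)) (p (f n)) \<ge> \<epsilon>/2} \<union> {n. \<not> L n \<subseteq> Y.mball (w n) (\<delta>/2)}"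
      define U where "U = (Y.mball y (\<delta>/2) \<inter> H) - \<Union>(L ` B)"
      have "finite B" unfolding B_def using f(2)[of "\<epsilon>/2"] near[of "\<delta>/2"] \<epsilon> \<delta> by simp
      then have "closedin Y (\<Union>(L ` B))"
        using csL by (intro closedin_Union) (auto simp: clopen_sat_def)
      moreover have opH: "openin Y H" using H by (simp add: clopen_sat_def)
      then have "openin Y (Y.mball y (\<delta>/2) \<inter> H)"
        using d(2) Y.openin_mball[of y "\<delta>/2"] by (intro openin_Int) auto
      ultimately have "openin Y U" unfolding U_def by (rule openin_diff[rotated])
      then have "openin (subtopology Y H) U"
        unfolding openin_open_subtopology[OF opH] by (auto simp: U_def)
      moreover have "y \<in> U"
        unfolding U_def using True yH W_sub \<delta> L_Un by auto
      moreover have "q z \<in> D.mball (q y) \<epsilon>" if z: "z \<in> U" for z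
      proof (cases "z \<in> W")
        case zW: True
        have "d y z < \<delta>" using z \<delta>(1) by (auto simp: U_def)
        then have "e (g y) (g z) < \<epsilon>/2" using \<delta>(2)[OF zW] by simp
        then show ?thesis using qW[OF True] qW[OF zW] gW[OF True] gW[OF zW] \<epsilon> by auto
      next
        case False
        then obtain n where n: "z \<in> L n" using z H_cases unfolding U_def by blast
        then have "n \<notin> B" using z unfolding U_def by blast
        then have "z \<in> Y.mball (w n) (\<delta>/2)" and en: "e (g (w n)) (c n) < \<epsilon>/2"
          using n unfolding B_def c_def by auto
        moreover have "d y z < \<delta>/2" using z by (auto simp: U_def)
        moreover have "y \<in> topspace Y" using True W_sub by blast
        ultimately have "d y (w n) < \<delta>" using Y.triangle[of y z "w n"] by (auto simp: Y.commute)
        then have "e (g y) (g (w n)) < \<epsilon>/2" using \<delta>(2)[OF w(1)] by simp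
        moreover have cD: "c n \<in> topspace D" using cP PD(1) by blast
        ultimately have "e (g y) (c n) < \<epsilon>"
          using en D.triangle[of "g y" "g (w n)" "c n"] gW[OF True] gW[OF w(1), of n] by auto
        then show ?thesis using qL[OF n] qW[OF True] gW[OF True] cD by auto
      qed
      ultimately show ?thesis by blast
    qed
  qed
  then have "continuous_map (subtopology Y H) D q" using e(2) by simp
  moreover have "q ` H = topspace D"
  proof
    show "q ` H \<subseteq> topspace D"
    proof clarify
      fix y assume "y \<in> H"
      then consider "y \<in> W" | n where "y \<in> L n" using H_cases by blast
      then show "q y \<in> topspace D"
      proof cases
        case 1
        then show ?thesis using qW gW by simp
      next
        case 2
        then show ?thesis using qL cP PD(1) by auto
      qed
    qed
    show "topspace D \<subseteq> q ` H"
    proof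
      fix z assume z: "z \<in> topspace D"
      show "z \<in> q ` H"
      proof (cases "z \<in> P")
        case True
        then obtain n where "z = c n" using c by (auto simp: bij_betw_def)
        then have "z = q (l n)" "l n \<in> H" using qL[OF l[of n]] l[of n] L_H[of n] by auto
        then show ?thesis by blast
      next
        case False
        then obtain v where "v \<in> W" "z = g v" using z g_im by blast
        then have "z = q v" "v \<in> H" using qW W_sub by auto
        then show ?thesis by blast
      qed
    qed
  qed
  moreover have "inj_on q {y \<in> H. q y \<notin> P}"
  proof (rule inj_onI)
    fix y z assume yz: "y \<in> {y \<in> H. q y \<notin> P}" "z \<in> {y \<in> H. q y \<notin> P}" "q y = q z"
    have "v \<in> W" if "v \<in> H" "q v \<notin> P" for v
      using H_cases[OF that(1)] qL cP that(2) by metis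
    then have "y \<in> W" "z \<in> W" using yz by auto
    then show "y = z" using yz(3) qW g_inj by (auto dest: inj_onD)
  qed
  moreover have "clopen_sat {y \<in> H. q y = z} \<and> ({y \<in> H. q y = z} \<subseteq> E \<or> {y \<in> H. q y = z} \<inter> E = {})"
    if "z \<in> P" for z
  proof -
    obtain n where "z = c n" using c \<open>z \<in> P\<close> by (auto simp: bij_betw_def)
    then show ?thesis using q_fibre csL refine by simp
  qed
  moreover have "q ` Z0 \<inter> P = {}" if Z0: "Z0 \<in> members" "Z0 \<subseteq> H"
  proof -
    obtain i where "i < k" "Z0 \<in> YF i" using Z0(1) by (auto simp: members_def)
    then have "Z0 \<subseteq> W" using Zs(3) Z0(2) unfolding W_def \<W>_def by blast
    then show ?thesis using qW gW by fastforce
  qed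
  ultimately show ?thesis by blast
qed

end

section \<open>Points of the wedge\<close>

lemma openin_quotient_topology:
  "openin (quotient_topology X f) U \<longleftrightarrow> U \<subseteq> f ` topspace X \<and> openin X {x \<in> topspace X. f x \<in> U}"
proof -
  have "istopology (\<lambda>U. U \<subseteq> f ` topspace X \<and> openin X {x \<in> topspace X. f x \<in> U})"
    unfolding istopology_def
  proof (intro conjI allI impI)
    fix S T assume "S \<subseteq> f ` topspace X \<and> openin X {x \<in> topspace X. f x \<in> S}"
      "T \<subseteq> f ` topspace X \<and> openin X {x \<in> topspace X. f x \<in> T}"
    moreover have "{x \<in> topspace X. f x \<in> S \<inter> T} = {x \<in> topspace X. f x \<in> S} \<inter> {x \<in> topspace X. f x \<in> T}"
      by auto
    ultimately show "S \<inter> T \<subseteq> f ` topspace X" "openin X {x \<in> topspace X. f x \<in> S \<inter> T}"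
      by (auto simp: openin_Int)
  next
    fix \<K> assume \<K>: "\<forall>K\<in>\<K>. K \<subseteq> f ` topspace X \<and> openin X {x \<in> topspace X. f x \<in> K}"
    then show "\<Union>\<K> \<subseteq> f ` topspace X" by blast
    have "{x \<in> topspace X. f x \<in> \<Union>\<K>} = (\<Union>K\<in>\<K>. {x \<in> topspace X. f x \<in> K})" by auto
    moreover have "openin X (\<Union>K\<in>\<K>. {x \<in> topspace X. f x \<in> K})"
      using \<K> by (intro openin_Union) auto
    ultimately show "openin X {x \<in> topspace X. f x \<in> \<Union>\<K>}" by simp
  qed
  then show ?thesis by (simp add: quotient_topology_def)
qed

lemma topspace_quotient_topology [simp]: "topspace (quotient_topology X f) = f ` topspace X"
proof
  show "topspace (quotient_topology X f) \<subseteq> f ` topspace X"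
    using openin_quotient_topology[of X f "topspace (quotient_topology X f)"] by simp
  have "{x \<in> topspace X. f x \<in> f ` topspace X} = topspace X" by auto
  then have "openin (quotient_topology X f) (f ` topspace X)"
    by (simp add: openin_quotient_topology)
  then show "f ` topspace X \<subseteq> topspace (quotient_topology X f)" by (rule openin_subset)
qed

lemma continuous_map_quotient_topology: "continuous_map X (quotient_topology X f) f"
  by (auto simp: continuous_map_def openin_quotient_topology)

lemma continuous_map_from_quotient_topology:
  assumes "continuous_map X Z (\<lambda>x. h (f x))"
  shows "continuous_map (quotient_topology X f) Z h"
  unfolding continuous_map_def
proof (intro conjI allI impI)
  show "h \<in> topspace (quotient_topology X f) \<rightarrow> topspace Z"
    using continuous_map_funspace[OF assms] by auto
  fix U assume "openin Z U"
  then have "openin X {x \<in> topspace X. h (f x) \<in> U}"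
    using assms openin_continuous_map_preimage by fastforce
  moreover have "{x \<in> topspace X. f x \<in> {y \<in> topspace (quotient_topology X f). h y \<in> U}} =
      {x \<in> topspace X. h (f x) \<in> U}" by auto
  ultimately show "openin (quotient_topology X f) {y \<in> topspace (quotient_topology X f). h y \<in> U}"
    by (auto simp: openin_quotient_topology)
qed

section \<open>Coordinates of points in the wedge\<close>

locale peripheral_tree =
  fixes S :: "'s topology" and Xdd :: "nat list \<Rightarrow> 'b topology" and P :: "nat list \<Rightarrow> 'b set"
    and b :: "nat list \<Rightarrow> nat list \<Rightarrow> 'b"
  assumes tree_system: "tree_system S Xdd P b"
begin

lemma peripheral_extension: "peripheral_extension S (Xdd t) (P t)"
  using tree_system by (simp add: tree_system_def)

lemma b_bij: "bij_betw (b t) (nbrs t) (P t)"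
  using tree_system by (simp add: tree_system_def)

lemma b_in_P: "tadj t s \<Longrightarrow> b t s \<in> P t"
  using b_bij[of t] by (auto simp: bij_betw_def nbrs_def)

lemma b_inj: "tadj t s \<Longrightarrow> tadj t s' \<Longrightarrow> b t s = b t s' \<Longrightarrow> s = s'"
  using b_bij[of t] by (auto simp: bij_betw_def nbrs_def dest: inj_onD)

lemma b_in_topspace: "tadj t s \<Longrightarrow> b t s \<in> topspace (Xdd t)"
  using b_in_P[of t s] peripheral_extension[of t] by (auto simp: peripheral_extension_def)

lemma Hausdorff_Xdd: "Hausdorff_space (Xdd t)"
  using peripheral_extension[of t] metrizable_imp_Hausdorff_space
  by (auto simp: peripheral_extension_def)

lemma wcls_edge:
  assumes "t \<in> F" "s \<in> F" "tadj t s"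
  shows "wcls Xdd b F (t, b t s) = {(t, b t s), (s, b s t)}"
proof -
  have "tadj s t" using assms(3) tadj_sym by blast
  then show ?thesis
    using assms b_in_topspace by (auto simp: wcls_def dest: b_inj)
qed

lemma wcls_edge_swap:
  assumes "t \<in> F" "s \<in> F" "tadj t s"
  shows "wcls Xdd b F (t, b t s) = wcls Xdd b F (s, b s t)"
  using wcls_edge[OF assms] wcls_edge[OF assms(2,1)] assms(3) tadj_sym by auto

lemma wcls_singleton:
  assumes "t \<in> F" "x \<in> topspace (Xdd t)" "\<And>s. s \<in> F \<Longrightarrow> tadj t s \<Longrightarrow> x \<noteq> b t s"
  shows "wcls Xdd b F (t, x) = {(t, x)}"
  using assms by (auto simp: wcls_def)

text \<open>\<open>wcls\<close> takes no transitive closure, yet its sets are true classes: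
  \<open>b t\<close> is injective, so a peripheral point is identified with at most one other
  point.\<close>

lemma wcls_eq:
  assumes "p \<in> wcls Xdd b F p0"
  shows "wcls Xdd b F p = wcls Xdd b F p0"
proof (cases "p = p0")
  case False
  then obtain t s where "t \<in> F" "s \<in> F" "tadj t s" "p0 = (t, b t s)" "p = (s, b s t)"
    using assms by (auto simp: wcls_def)
  then show ?thesis using wcls_edge_swap by simp
qed simp

text \<open>Over a one-vertex subtree nothing is identified, so for points of the wedge
  \<open>c {t}\<close> is a singleton and \<open>SOME\<close> has no choice.\<close>

definition coord :: "(nat list set \<Rightarrow> (nat list \<times> 'b) set) \<Rightarrow> nat list \<Rightarrow> 'b" where
  "coord c t = snd (SOME p. p \<in> c {t})"

lemma topspace_wedgeF: "topspace (wedgeF Xdd b F) = wcls Xdd b F ` Sigma F (topspace \<circ> Xdd)"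
  by (simp add: wedgeF_def)

text \<open>The bonding maps from \<open>F\<close> to its one-vertex subtrees send a representative
  \<open>(s, x)\<close> to the peripheral points facing \<open>s\<close>.\<close>

lemma wedge_point:
  assumes c: "c \<in> topspace (wedge Xdd b)" and F: "F \<in> subtrees"
  shows "\<exists>s\<in>F. c F = wcls Xdd b F (s, coord c s) \<and> (\<forall>t\<in>F. t \<noteq> s \<longrightarrow> coord c t = b t (toward t s)) \<and>
    coord c s \<in> topspace (Xdd s)"
proof -
  have c_in: "c F \<in> wcls Xdd b F ` Sigma F (topspace \<circ> Xdd)"
    using c F by (auto simp: wedge_def PiE_iff topspace_wedgeF)
  have c_rho: "rho Xdd b {u} (c F) = c {u}" if "u \<in> F" for u
    using c F that by (auto simp: wedge_def)
  obtain p0 where p0: "p0 \<in> Sigma F (topspace \<circ> Xdd)" "c F = wcls Xdd b F p0"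
    using c_in by blast
  \<comment> \<open>\<open>rho\<close> works with this particular representative, so
    \<open>s\<close> must be its vertex rather than that of \<open>p0\<close>.\<close>
  define p where "p = (SOME p. p \<in> c F)"
  have "p0 \<in> c F" using p0 by (auto simp: wcls_def)
  then have pc: "p \<in> c F" unfolding p_def by (rule someI)
  then have cF: "c F = wcls Xdd b F p" using wcls_eq p0(2) by simp
  obtain s x where sx: "p = (s, x)" by fastforce
  have s: "s \<in> F" "x \<in> topspace (Xdd s)" using pc p0(2) sx by (auto simp: wcls_def)
  have coord: "coord c u = (if u = s then x else b u (toward u s))" if u: "u \<in> F" for u
  proof -
    have "nearest {u} s = u" using nearest_props(1)[of "{u}" s] by simp
    then have "rho_pt b {u} (s, x) = (u, if u = s then x else b u (toward u s))"
      by (simp add: rho_pt_def)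
    moreover have "rho Xdd b {u} (c F) = wcls Xdd b {u} (rho_pt b {u} (s, x))"
      unfolding rho_def p_def[symmetric] by (simp only: sx)
    ultimately have "c {u} = wcls Xdd b {u} (u, if u = s then x else b u (toward u s))"
      using c_rho[OF u] by simp
    also have "\<dots> = {(u, if u = s then x else b u (toward u s))}"
      using s toward_props(1)[of u s] by (intro wcls_singleton) (auto intro: b_in_topspace)
    finally show ?thesis by (simp add: coord_def)
  qed
  show ?thesis
    using s cF coord sx by (intro bexI[of _ s]) auto
qed

lemma coord_in_topspace:
  assumes "c \<in> topspace (wedge Xdd b)"
  shows "coord c t \<in> topspace (Xdd t)"
  using wedge_point[OF assms singleton_subtree[of t]] by auto

lemma coord_edge:
  assumes "c \<in> topspace (wedge Xdd b)"
  shows "coord c t = b t (t @ [n]) \<or> coord c (t @ [n]) = b (t @ [n]) t"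
proof -
  have "tadj (t @ [n]) t" using tadj_sym tadj_snoc by blast
  then have "toward (t @ [n]) t = t" "toward t (t @ [n]) = t @ [n]" by (simp_all add: toward_adj)
  then show ?thesis using wedge_point[OF assms edge_subtree[of t n]] by auto
qed

text \<open>If \<open>c F\<close> were represented at a vertex \<open>u\<close> other than
  \<open>t\<close> and \<open>s\<close>, the steps from \<open>t\<close> to \<open>s\<close> and
  back would both lead closer to \<open>u\<close>. So over every \<open>F\<close> containing
  \<open>t\<close> the point is the class of the edge.\<close>

lemma coord_not_peripheral:
  assumes c: "c \<in> topspace (wedge Xdd b)" "c \<notin> periph_pts Xdd b" and ts: "tadj t s"
  shows "\<not> (coord c t = b t s \<and> coord c s = b s t)"
proof
  assume eq: "coord c t = b t s \<and> coord c s = b s t"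
  have st: "tadj s t" using ts tadj_sym by blast
  have "c F = wcls Xdd b F (t, b t s)" if F: "F \<in> subtrees" "t \<in> F" for F
  proof -
    obtain u where u: "u \<in> F" "c F = wcls Xdd b F (u, coord c u)"
        "\<And>v. v \<in> F \<Longrightarrow> v \<noteq> u \<Longrightarrow> coord c v = b v (toward v u)"
      using wedge_point[OF c(1) F(1)] by blast
    show ?thesis
    proof (cases "u = t")
      case True
      then show ?thesis using u eq by simp
    next
      case False
      note tu = toward_props[OF False[symmetric]]
      have s: "toward t u = s" using u(3)[OF F(2)] False eq tu(1) ts b_inj by metis
      then have sF: "s \<in> F" using toward_in_subtree[OF F u(1)] False by auto
      show ?thesis
      proof (cases "u = s")
        case True
        then show ?thesis using u(2) eq wcls_edge_swap[OF F(2) sF ts] by simp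
      next
        case us: False
        note su = toward_props[OF us[symmetric]]
        have "toward s u = t" using u(3)[OF sF] us eq su(1) st b_inj by metis
        then show ?thesis using tu(2) su(2) s by simp
      qed
    qed
  qed
  then have "c \<in> periph_pts Xdd b" using c(1) ts unfolding periph_pts_def by blast
  then show False using c(2) by simp
qed

lemma continuous_map_coord: "continuous_map (wedge Xdd b) (Xdd t) (\<lambda>c. coord c t)"
proof -
  let ?h = "\<lambda>C::(nat list \<times> 'b) set. snd (SOME p. p \<in> C)"
  have single: "?h (wcls Xdd b {t} (t, x)) = x" if "x \<in> topspace (Xdd t)" for x
    using wcls_singleton[of t "{t}" x] that by simp
  have "continuous_map (sum_topology Xdd {t}) (Xdd t) (\<lambda>p. ?h (wcls Xdd b {t} p))"
    unfolding continuous_map_def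
  proof (intro conjI allI impI)
    show "(\<lambda>p. ?h (wcls Xdd b {t} p)) \<in> topspace (sum_topology Xdd {t}) \<rightarrow> topspace (Xdd t)"
      using single by auto
    fix U assume U: "openin (Xdd t) U"
    have "{x. (t, x) \<in> {p \<in> topspace (sum_topology Xdd {t}). ?h (wcls Xdd b {t} p) \<in> U}} = U"
      using single openin_subset[OF U] by auto
    then show "openin (sum_topology Xdd {t}) {p \<in> topspace (sum_topology Xdd {t}). ?h (wcls Xdd b {t} p) \<in> U}"
      using U unfolding openin_sum_topology by auto
  qed
  then have "continuous_map (wedgeF Xdd b {t}) (Xdd t) ?h"
    unfolding wedgeF_def by (rule continuous_map_from_quotient_topology)
  moreover have "continuous_map (wedge Xdd b) (wedgeF Xdd b {t}) (\<lambda>c. c {t})"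
    unfolding wedge_def
    by (intro continuous_map_from_subtopology continuous_map_product_projection singleton_subtree)
  ultimately show ?thesis
    using continuous_map_compose unfolding coord_def comp_def by blast
qed

end

section \<open>Mapping a decomposed space to the wedge\<close>

text \<open>In \<open>q_image\<close> the point facing the parent is left out, because that value is
  reserved for the points outside \<open>H t\<close>.\<close>

locale amalgam_chart = peripheral_tree S Xdd P b
  for S :: "'s topology" and Xdd :: "nat list \<Rightarrow> 'b topology" and P :: "nat list \<Rightarrow> 'b set"
    and b :: "nat list \<Rightarrow> nat list \<Rightarrow> 'b" +
  fixes Y :: "'y topology" and H :: "nat list \<Rightarrow> 'y set" and q :: "nat list \<Rightarrow> 'y \<Rightarrow> 'b"
  assumes compact_Y: "compact_space Y"
    and H_Nil: "H [] = topspace Y"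
    and H_snoc: "H (t @ [n]) = {y \<in> H t. q t y = b t (t @ [n])}"
    and open_H: "openin Y (H t)" and closed_H: "closedin Y (H t)"
    and q_cont: "continuous_map (subtopology Y (H t)) (Xdd t) (q t)"
    and q_image: "q t ` H t = topspace (Xdd t) - {x. t \<noteq> [] \<and> x = b t (butlast t)}"
    and separating: "y \<in> topspace Y \<Longrightarrow> z \<in> topspace Y \<Longrightarrow> y \<noteq> z \<Longrightarrow>
      \<exists>t. y \<in> H t \<and> z \<in> H t \<and> q t y \<noteq> q t z"
begin

text \<open>Since \<open>H []\<close> is all of \<open>Y\<close>, no point of \<open>Y\<close> meets
  the meaningless default at the root.\<close>

definition proj :: "nat list \<Rightarrow> 'y \<Rightarrow> 'b" where
  "proj t y = (if y \<in> H t then q t y else b t (butlast t))"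

lemma H_subset: "H t \<subseteq> topspace Y"
  using open_H openin_subset by blast

lemma outside_H: "y \<in> topspace Y \<Longrightarrow> y \<notin> H t \<Longrightarrow> t \<noteq> []"
  using H_Nil by auto

lemma proj_in_topspace:
  assumes "y \<in> topspace Y" shows "proj t y \<in> topspace (Xdd t)"
proof (cases "y \<in> H t")
  case True
  then show ?thesis using q_image[of t] by (auto simp: proj_def)
next
  case False
  then show ?thesis
    using b_in_topspace[OF tadj_butlast] outside_H[OF assms] by (auto simp: proj_def)
qed

lemma continuous_map_proj: "continuous_map Y (Xdd t) (proj t)"
  unfolding continuous_map_def
proof (intro conjI allI impI)
  show "proj t \<in> topspace Y \<rightarrow> topspace (Xdd t)" using proj_in_topspace by auto
  fix U assume U: "openin (Xdd t) U"
  have "openin (subtopology Y (H t)) {y \<in> topspace (subtopology Y (H t)). q t y \<in> U}"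
    using q_cont U by (rule openin_continuous_map_preimage)
  moreover have "{y \<in> topspace (subtopology Y (H t)). q t y \<in> U} = {y \<in> H t. q t y \<in> U}"
    using H_subset by auto
  ultimately have "openin Y {y \<in> H t. q t y \<in> U}"
    using openin_trans_full[OF _ open_H] by simp
  moreover have "openin Y (if b t (butlast t) \<in> U then topspace Y - H t else {})"
    using closed_H by auto
  ultimately have "openin Y ({y \<in> H t. q t y \<in> U} \<union> (if b t (butlast t) \<in> U then topspace Y - H t else {}))"
    by (rule openin_Un)
  moreover have "{y \<in> topspace Y. proj t y \<in> U} =
      {y \<in> H t. q t y \<in> U} \<union> (if b t (butlast t) \<in> U then topspace Y - H t else {})"
    using H_subset by (auto simp: proj_def)
  ultimately show "openin Y {y \<in> topspace Y. proj t y \<in> U}" by simp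
qed

lemma in_H_snoc_iff:
  assumes "y \<in> topspace Y"
  shows "y \<in> H (t @ [n]) \<longleftrightarrow> proj t y = b t (t @ [n])"
proof (cases "y \<in> H t")
  case True
  then show ?thesis by (simp add: H_snoc proj_def)
next
  case False
  then have ne: "t \<noteq> []" using outside_H[OF assms] by blast
  have "butlast t \<noteq> t @ [n]"
    by (metis length_append_singleton length_butlast diff_le_self Suc_n_not_le_n)
  then have "b t (butlast t) \<noteq> b t (t @ [n])"
    using b_inj[OF tadj_butlast[OF ne] tadj_snoc] by blast
  then show ?thesis using False by (simp add: H_snoc proj_def)
qed

lemma in_H_iff:
  assumes "y \<in> topspace Y" "t \<noteq> []"
  shows "y \<in> H t \<longleftrightarrow> proj t y \<noteq> b t (butlast t)"
proof
  assume y: "y \<in> H t"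
  then have "q t y \<in> q t ` H t" by blast
  then show "proj t y \<noteq> b t (butlast t)" using y assms(2) unfolding q_image proj_def by simp
qed (auto simp: proj_def split: if_splits)

lemma H_antimono: "prefix t s \<Longrightarrow> H s \<subseteq> H t"
proof (induction s rule: rev_induct)
  case (snoc n s)
  then show ?case using H_snoc[of s n] by auto
qed auto

text \<open>Otherwise \<open>y\<close> would lie in two children of the longest common prefix, which
  are fibres of one map over different points.\<close>

lemma H_comparable:
  assumes "y \<in> H t" "y \<in> H s"
  shows "prefix t s \<or> prefix s t"
proof (rule ccontr)
  assume no: "\<not> ?thesis"
  let ?m = "longest_common_prefix t s"
  have m: "prefix ?m t" "prefix ?m s"
    by (simp_all add: longest_common_prefix_prefix1 longest_common_prefix_prefix2)
  then have "?m \<noteq> t" "?m \<noteq> s" using no by metis+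
  then obtain i j where ij: "prefix (?m @ [i]) t" "prefix (?m @ [j]) s"
    using m prefix_snoc_obtain by metis
  have "y \<in> H (?m @ [i])" "y \<in> H (?m @ [j])"
    using assms ij H_antimono by blast+
  then have "b ?m (?m @ [i]) = b ?m (?m @ [j])" by (simp add: H_snoc)
  then have "?m @ [i] = ?m @ [j]" by (rule b_inj[OF tadj_snoc tadj_snoc])
  then have "prefix (?m @ [i]) ?m" using ij by (intro longest_common_prefix_max_prefix) auto
  then show False using prefix_length_le by fastforce
qed

text \<open>The value \<open>b t s\<close> of \<open>proj t y\<close> says that \<open>y\<close> lies beyond the edge \<open>[t, s]\<close>. Hence the image of \<open>y\<close> in the
  wedge over \<open>F\<close> is represented at the only vertex of \<open>F\<close> from which \<open>y\<close> is not seen across an edge of \<open>F\<close>.\<close>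

definition carrier_vertex :: "nat list set \<Rightarrow> 'y \<Rightarrow> nat list \<Rightarrow> bool" where
  "carrier_vertex F y t \<longleftrightarrow> t \<in> F \<and> (\<forall>s\<in>F. tadj t s \<longrightarrow> proj t y \<noteq> b t s)"

text \<open>If \<open>y\<close> lies in \<open>H t\<close> for some \<open>t\<close> in
  \<open>F\<close>, the deepest such vertex is the carrier. If not, all coordinates face the parent,
  and the root of \<open>F\<close>, whose parent is outside \<open>F\<close>, is the
  carrier.\<close>

lemma carrier_vertex_exists:
  assumes y: "y \<in> topspace Y" and F: "F \<in> subtrees"
  shows "\<exists>t0. carrier_vertex F y t0 \<and> (\<forall>t\<in>F. t \<noteq> t0 \<longrightarrow> proj t y = b t (toward t t0))"
proof (cases "\<exists>t\<in>F. y \<in> H t")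
  case True
  then obtain v where v: "v \<in> F" "y \<in> H v" by blast
  obtain B where B: "\<And>u. u \<in> F \<Longrightarrow> length u < B"
    using subtreesD(1)[OF F] finite_nat_set_iff_bounded[of "length ` F"] by auto
  have "\<exists>t. (t \<in> F \<and> y \<in> H t) \<and> (\<forall>u. u \<in> F \<and> y \<in> H u \<longrightarrow> length u \<le> length t)"
    using v B by (intro ex_has_greatest_nat[where k = v and b = B]) auto
  then obtain t0 where t0: "t0 \<in> F" "y \<in> H t0"
    and longest: "\<And>u. u \<in> F \<Longrightarrow> y \<in> H u \<Longrightarrow> length u \<le> length t0" by blast
  have "proj t0 y \<noteq> b t0 s" if s: "s \<in> F" "tadj t0 s" for s
    using s(2)
  proof (cases rule: tadj_cases)
    case (1 n)
    then show ?thesis using in_H_snoc_iff[OF y, of t0 n] longest[OF s(1)] by auto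
  next
    case 2
    then show ?thesis using in_H_iff[OF y] t0 by simp
  qed
  moreover have "proj t y = b t (toward t t0)" if t: "t \<in> F" "t \<noteq> t0" for t
  proof (cases "y \<in> H t")
    case True
    have "prefix t t0"
      using H_comparable[OF True t0(2)] longest[OF t(1) True] prefix_long_eq by blast
    then obtain n where n: "prefix (t @ [n]) t0" using t(2) by (rule prefix_snoc_obtain)
    then have "y \<in> H (t @ [n])" using H_antimono t0(2) by blast
    then show ?thesis using in_H_snoc_iff[OF y] toward_down[OF n] by simp
  next
    case False
    then have "\<not> prefix t t0" using H_antimono t0(2) by blast
    then show ?thesis using False by (simp add: proj_def toward_up)
  qed
  ultimately show ?thesis using t0(1) unfolding carrier_vertex_def by blast
next
  case False
  obtain r where r: "r \<in> F" "\<And>u. u \<in> F \<Longrightarrow> prefix r u" using subtree_root[OF F] by blast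
  have "proj r y \<noteq> b r s" if s: "s \<in> F" "tadj r s" for s
    using s(2)
  proof (cases rule: tadj_cases)
    case (1 n)
    then show ?thesis using in_H_snoc_iff[OF y, of r n] False s by auto
  next
    case 2
    then show ?thesis using prefix_length_le[OF r(2)[OF s(1)]] by (cases r) auto
  qed
  moreover have "proj t y = b t (toward t r)" if t: "t \<in> F" "t \<noteq> r" for t
  proof -
    have "\<not> prefix t r" using r t prefix_order.antisym by blast
    then show ?thesis using False t by (auto simp: proj_def toward_up)
  qed
  ultimately show ?thesis using r(1) unfolding carrier_vertex_def by blast
qed

definition carrier_of :: "nat list set \<Rightarrow> 'y \<Rightarrow> nat list" where
  "carrier_of F y = (SOME t. carrier_vertex F y t)"

lemma carrier_vertex_toward:
  assumes "y \<in> topspace Y" "F \<in> subtrees" "carrier_vertex F y t0" "t \<in> F" "t \<noteq> t0"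
  shows "proj t y = b t (toward t t0)"
proof -
  obtain t1 where t1: "carrier_vertex F y t1" "\<And>t. t \<in> F \<Longrightarrow> t \<noteq> t1 \<Longrightarrow> proj t y = b t (toward t t1)"
    using carrier_vertex_exists[OF assms(1,2)] by blast
  have "t0 = t1"
  proof (rule ccontr)
    assume ne: "t0 \<noteq> t1"
    have "t0 \<in> F" "t1 \<in> F" using t1(1) assms(3) by (auto simp: carrier_vertex_def)
    then have "toward t0 t1 \<in> F" "tadj t0 (toward t0 t1)" "proj t0 y = b t0 (toward t0 t1)"
      using toward_in_subtree[OF assms(2)] toward_props(1)[OF ne] t1(2) ne by auto
    then show False using assms(3) by (auto simp: carrier_vertex_def)
  qed
  with t1(2) assms(4,5) show ?thesis by blast
qed

lemma carrier_vertex_unique: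
  assumes "y \<in> topspace Y" "F \<in> subtrees" "carrier_vertex F y t0" "carrier_vertex F y t1"
  shows "t0 = t1"
proof (rule ccontr)
  assume ne: "t0 \<noteq> t1"
  have in_F: "t0 \<in> F" "t1 \<in> F" using assms(3,4) by (auto simp: carrier_vertex_def)
  have "proj t0 y = b t0 (toward t0 t1)" using carrier_vertex_toward[OF assms(1,2,4) in_F(1) ne] .
  moreover have "toward t0 t1 \<in> F" by (rule toward_in_subtree[OF assms(2) in_F ne])
  ultimately show False
    using assms(3) toward_props(1)[OF ne] by (auto simp: carrier_vertex_def)
qed

lemma carrier_of:
  assumes "y \<in> topspace Y" "F \<in> subtrees"
  shows "carrier_vertex F y (carrier_of F y)"
  unfolding carrier_of_def using carrier_vertex_exists[OF assms] by (metis someI)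

lemma carrier_of_eq:
  assumes "y \<in> topspace Y" "F \<in> subtrees" "carrier_vertex F y t"
  shows "carrier_of F y = t"
  using carrier_vertex_unique[OF assms(1,2) carrier_of[OF assms(1,2)] assms(3)] .

definition to_wedge :: "'y \<Rightarrow> nat list set \<Rightarrow> (nat list \<times> 'b) set" where
  "to_wedge y = (\<lambda>F\<in>subtrees. wcls Xdd b F (carrier_of F y, proj (carrier_of F y) y))"

lemma to_wedge_singleton:
  assumes y: "y \<in> topspace Y" and F: "F \<in> subtrees" and t: "carrier_vertex F y t"
  shows "to_wedge y F = {(t, proj t y)}"
proof -
  have "wcls Xdd b F (t, proj t y) = {(t, proj t y)}"
    using t proj_in_topspace[OF y] by (intro wcls_singleton) (auto simp: carrier_vertex_def)
  then show ?thesis using F carrier_of_eq[OF y F t] by (simp add: to_wedge_def)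
qed

lemma to_wedge_in_wedge:
  assumes y: "y \<in> topspace Y"
  shows "to_wedge y \<in> topspace (wedge Xdd b)"
proof -
  have "wcls Xdd b F (carrier_of F y, proj (carrier_of F y) y) \<in> topspace (wedgeF Xdd b F)"
    if F: "F \<in> subtrees" for F
  proof -
    have "carrier_of F y \<in> F" using carrier_of[OF y F] by (simp add: carrier_vertex_def)
    then show ?thesis using proj_in_topspace[OF y] by (auto simp: topspace_wedgeF)
  qed
  then have "to_wedge y \<in> topspace (product_topology (wedgeF Xdd b) subtrees)"
    by (simp add: to_wedge_def)
  moreover have "rho Xdd b F' (to_wedge y F) = to_wedge y F'"
    if F: "F \<in> subtrees" and F': "F' \<in> subtrees" and sub: "F' \<subseteq> F" for F F'
  proof -
    define t where "t = carrier_of F y"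
    have t: "carrier_vertex F y t" using carrier_of[OF y F] by (simp add: t_def)
    have "(SOME p. p \<in> to_wedge y F) = (t, proj t y)"
      using to_wedge_singleton[OF y F t] by simp
    then have rho: "rho Xdd b F' (to_wedge y F) = wcls Xdd b F' (rho_pt b F' (t, proj t y))"
      by (simp add: rho_def)
    show ?thesis
    proof (cases "t \<in> F'")
      case True
      then have "carrier_vertex F' y t" using t sub by (auto simp: carrier_vertex_def)
      then show ?thesis
        using rho True F' carrier_of_eq[OF y F'] by (simp add: rho_pt_def to_wedge_def)
    next
      case False
      \<comment> \<open>The coordinate at \<open>u\<close> faces \<open>t\<close>. The vertex it
        faces is closer to \<open>t\<close> than \<open>u\<close>, hence outside \<open>F'\<close>,
        so \<open>u\<close> carries \<open>y\<close> over \<open>F'\<close>, as \<open>rho\<close>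
        prescribes.\<close>
      define u where "u = nearest F' t"
      have u: "u \<in> F'" "\<And>v. v \<in> F' \<Longrightarrow> v \<noteq> u \<Longrightarrow> tdist u t < tdist v t"
        using nearest_props[OF F'] unfolding u_def by auto
      then have ut: "u \<noteq> t" using False by auto
      have pu: "proj u y = b u (toward u t)"
        using carrier_vertex_toward[OF y F t] u(1) sub ut by blast
      have "proj u y \<noteq> b u s" if s: "s \<in> F'" "tadj u s" for s
      proof
        assume "proj u y = b u s"
        then have "s = toward u t" using pu b_inj[OF s(2) toward_props(1)[OF ut]] by simp
        then have "tdist s t < tdist u t" "s \<noteq> u" using toward_props(2)[OF ut] by auto
        then show False using u(2)[OF s(1)] by simp
      qed
      then have "carrier_vertex F' y u" using u(1) by (simp add: carrier_vertex_def)
      then have "to_wedge y F' = wcls Xdd b F' (u, proj u y)"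
        using F' carrier_of_eq[OF y F'] by (simp add: to_wedge_def)
      moreover have "rho_pt b F' (t, proj t y) = (u, proj u y)"
        using False pu by (simp add: rho_pt_def u_def[symmetric] Let_def)
      ultimately show ?thesis using rho by simp
    qed
  qed
  ultimately show ?thesis by (simp add: wedge_def)
qed

lemma coord_to_wedge:
  assumes y: "y \<in> topspace Y"
  shows "coord (to_wedge y) t = proj t y"
proof -
  have "carrier_vertex {t} y t" by (simp add: carrier_vertex_def)
  then show ?thesis using to_wedge_singleton[OF y singleton_subtree[of t]] by (simp add: coord_def)
qed

text \<open>Over the subtree \<open>{t, s}\<close> the peripheral point of that edge is a class of
  two elements, while the image of \<open>y\<close> is a singleton.\<close>

lemma to_wedge_not_peripheral:
  assumes y: "y \<in> topspace Y"
  shows "to_wedge y \<notin> periph_pts Xdd b"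
proof
  assume "to_wedge y \<in> periph_pts Xdd b"
  then obtain t s where ts: "tadj t s"
    "\<And>F. F \<in> subtrees \<Longrightarrow> t \<in> F \<Longrightarrow> to_wedge y F = wcls Xdd b F (t, b t s)"
    unfolding periph_pts_def by blast
  have F: "{t, s} \<in> subtrees"
    using ts(1) by (auto simp: tadj_def edge_subtree insert_commute)
  have "to_wedge y {t, s} = {(t, b t s), (s, b s t)}"
    using ts(2)[OF F] wcls_edge[of t "{t, s}" s] ts(1) by simp
  moreover have "to_wedge y {t, s} = {(carrier_of {t, s} y, proj (carrier_of {t, s} y) y)}"
    by (rule to_wedge_singleton[OF y F carrier_of[OF y F]])
  ultimately have "(t, b t s) \<in> {(carrier_of {t, s} y, proj (carrier_of {t, s} y) y)}"
    "(s, b s t) \<in> {(carrier_of {t, s} y, proj (carrier_of {t, s} y) y)}" by auto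
  then have "t = s" by simp
  then show False using ts(1) by simp
qed

lemma inj_on_to_wedge: "inj_on to_wedge (topspace Y)"
proof (rule inj_onI, rule ccontr)
  fix y z assume y: "y \<in> topspace Y" and z: "z \<in> topspace Y"
    and eq: "to_wedge y = to_wedge z" and ne: "y \<noteq> z"
  obtain t where "y \<in> H t" "z \<in> H t" "q t y \<noteq> q t z" using separating[OF y z ne] by blast
  then have "proj t y \<noteq> proj t z" by (simp add: proj_def)
  then show False using coord_to_wedge[OF y] coord_to_wedge[OF z] eq by metis
qed

text \<open>\<open>Y\<close> is covered by the sets on which a fixed \<open>t\<close> in
  \<open>F\<close> is the carrier. They are open because there \<open>proj t\<close> avoids a
  finite, hence closed, set, and on each of them the map factors through
  \<open>proj t\<close>.\<close>

lemma continuous_map_to_wedge: "continuous_map Y (wedge Xdd b) to_wedge"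
proof -
  have "continuous_map Y (wedgeF Xdd b F) (\<lambda>y. to_wedge y F)" if F: "F \<in> subtrees" for F
    unfolding continuous_map_def
  proof (intro conjI allI impI)
    show "(\<lambda>y. to_wedge y F) \<in> topspace Y \<rightarrow> topspace (wedgeF Xdd b F)"
      using to_wedge_in_wedge F by (auto simp: wedge_def PiE_iff)
    fix U assume U: "openin (wedgeF Xdd b F) U"
    have "openin Y {y \<in> topspace Y. carrier_vertex F y t \<and> wcls Xdd b F (t, proj t y) \<in> U}" if t: "t \<in> F" for t
    proof -
      let ?K = "b t ` {s \<in> F. tadj t s}"
      have "closedin (Xdd t) ?K"
        using subtreesD(1)[OF F] b_in_topspace Hausdorff_Xdd
        by (intro closedin_Hausdorff_finite) auto
      then have "openin (Xdd t) (topspace (Xdd t) - ?K)" by blast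
      then have "openin Y {y \<in> topspace Y. proj t y \<in> topspace (Xdd t) - ?K}"
        using continuous_map_proj openin_continuous_map_preimage by blast
      moreover have "{y \<in> topspace Y. proj t y \<in> topspace (Xdd t) - ?K} = {y \<in> topspace Y. carrier_vertex F y t}"
        using t proj_in_topspace by (auto simp: carrier_vertex_def)
      ultimately have op1: "openin Y {y \<in> topspace Y. carrier_vertex F y t}" by simp
      have "continuous_map Y (wedgeF Xdd b F) (\<lambda>y. wcls Xdd b F (t, proj t y))"
        using continuous_map_compose[OF continuous_map_compose[OF continuous_map_proj
              continuous_map_component_injection[OF t]] continuous_map_quotient_topology]
        unfolding wedgeF_def comp_def .
      then have op2: "openin Y {y \<in> topspace Y. wcls Xdd b F (t, proj t y) \<in> U}"
        using U openin_continuous_map_preimage by blast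
      have "{y \<in> topspace Y. carrier_vertex F y t \<and> wcls Xdd b F (t, proj t y) \<in> U} =
          {y \<in> topspace Y. carrier_vertex F y t} \<inter> {y \<in> topspace Y. wcls Xdd b F (t, proj t y) \<in> U}" by auto
      then show ?thesis using openin_Int[OF op1 op2] by simp
    qed
    then have "openin Y (\<Union>t\<in>F. {y \<in> topspace Y. carrier_vertex F y t \<and> wcls Xdd b F (t, proj t y) \<in> U})"
      by (intro openin_Union) auto
    moreover have "{y \<in> topspace Y. to_wedge y F \<in> U} =
        (\<Union>t\<in>F. {y \<in> topspace Y. carrier_vertex F y t \<and> wcls Xdd b F (t, proj t y) \<in> U})"
    proof -
      have "to_wedge y F \<in> U \<longleftrightarrow> (\<exists>t\<in>F. carrier_vertex F y t \<and> wcls Xdd b F (t, proj t y) \<in> U)"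
        if y: "y \<in> topspace Y" for y
      proof -
        have "carrier_of F y \<in> F" using carrier_of[OF y F] by (simp add: carrier_vertex_def)
        moreover have "to_wedge y F = wcls Xdd b F (t, proj t y)" if "carrier_vertex F y t" for t
          using F carrier_of_eq[OF y F that] by (simp add: to_wedge_def)
        ultimately show ?thesis using carrier_of[OF y F] by metis
      qed
      then show ?thesis by auto
    qed
    ultimately show "openin Y {y \<in> topspace Y. to_wedge y F \<in> U}" by simp
  qed
  then have "continuous_map Y (product_topology (wedgeF Xdd b) subtrees) to_wedge"
    by (simp add: continuous_map_componentwise to_wedge_def image_subset_iff)
  then show ?thesis
    unfolding wedge_def using to_wedge_in_wedge
    by (intro continuous_map_into_subtopology) (auto simp: wedge_def)
qed

text \<open>The vertex representing \<open>c F\<close> must be the carrier of \<open>y\<close>,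
  since at every other vertex of \<open>F\<close> the coordinate faces across an edge of
  \<open>F\<close>.\<close>

lemma proj_eq_coord_imp_to_wedge:
  assumes c: "c \<in> topspace (wedge Xdd b)" and y: "y \<in> topspace Y" and eq: "\<And>t. proj t y = coord c t"
  shows "to_wedge y = c"
proof
  fix F
  show "to_wedge y F = c F"
  proof (cases "F \<in> subtrees")
    case F: True
    obtain s where s: "s \<in> F" "c F = wcls Xdd b F (s, coord c s)"
        "\<And>t. t \<in> F \<Longrightarrow> t \<noteq> s \<Longrightarrow> coord c t = b t (toward t s)"
      using wedge_point[OF c F] by blast
    have t: "carrier_vertex F y (carrier_of F y)" by (rule carrier_of[OF y F])
    then have tF: "carrier_of F y \<in> F" by (simp add: carrier_vertex_def)
    have "carrier_of F y = s"
    proof (rule ccontr)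
      assume ne: "carrier_of F y \<noteq> s"
      show False
        using t s(3)[OF tF ne] eq toward_in_subtree[OF F tF s(1) ne] toward_props(1)[OF ne]
        by (auto simp: carrier_vertex_def)
    qed
    then show ?thesis using s(2) eq F by (simp add: to_wedge_def)
  next
    case False
    then show ?thesis using c by (auto simp: to_wedge_def wedge_def PiE_iff extensional_def)
  qed
qed

text \<open>The coordinates of \<open>c\<close> prescribe a descending path. A point common to the
  nested compact fibres along it has the right coordinates there, and off the path every coordinate
  faces the parent.\<close>

lemma exists_point_with_coords:
  assumes c: "c \<in> topspace (wedge Xdd b)" "c \<notin> periph_pts Xdd b"
  shows "\<exists>y\<in>topspace Y. \<forall>t. proj t y = coord c t"
proof -
  let ?x = "coord c"
  \<comment> \<open>Staying put when no child is faced makes a finite path an eventually constant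
    sequence, so it needs no separate treatment.\<close>
  define next_vertex where "next_vertex t = (if \<exists>n. ?x t = b t (t @ [n])
      then t @ [SOME n. ?x t = b t (t @ [n])] else t)" for t
  define v where "v i = (next_vertex ^^ i) []" for i
  have v0: "v 0 = []" and vS: "v (Suc i) = next_vertex (v i)" for i
    by (simp_all add: v_def)
  have next1: "next_vertex t = t @ [n]" if "?x t = b t (t @ [n])" for t n
  proof -
    have "?x t = b t (t @ [SOME n. ?x t = b t (t @ [n])])" using that by (rule someI)
    then have "t @ [SOME n. ?x t = b t (t @ [n])] = t @ [n]"
      using that by (intro b_inj[OF tadj_snoc tadj_snoc]) simp
    then show ?thesis using that unfolding next_vertex_def by auto
  qed
  have next2: "next_vertex t = t" if "\<And>n. ?x t \<noteq> b t (t @ [n])" for t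
    using that by (simp add: next_vertex_def)
  \<comment> \<open>As \<open>c\<close> is not peripheral, the coordinate cannot face back after a
    step down; so it lies in the image of \<open>q (v i)\<close> and the fibres are
    nonempty.\<close>
  have not_up: "v i \<noteq> [] \<longrightarrow> ?x (v i) \<noteq> b (v i) (butlast (v i))" for i
  proof (induction i)
    case 0
    then show ?case by (simp add: v0)
  next
    case (Suc i)
    show ?case
    proof (cases "\<exists>n. ?x (v i) = b (v i) (v i @ [n])")
      case True
      then obtain n where n: "?x (v i) = b (v i) (v i @ [n])" by blast
      then have "v (Suc i) = v i @ [n]" using next1 vS by simp
      then show ?thesis using coord_not_peripheral[OF c tadj_snoc[of "v i" n]] n by simp
    next
      case False
      then have "v (Suc i) = v i" using next2 vS by simp
      then show ?thesis using Suc by simp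
    qed
  qed
  define C where "C i = {z \<in> H (v i). q (v i) z = ?x (v i)}" for i
  have "C i \<noteq> {}" for i
  proof -
    have "?x (v i) \<in> q (v i) ` H (v i)"
      using not_up[of i] coord_in_topspace[OF c(1)] unfolding q_image by auto
    then show ?thesis unfolding C_def by auto
  qed
  moreover have "closedin Y (C i)" for i
  proof -
    have "closedin (Xdd (v i)) {?x (v i)}"
      using coord_in_topspace[OF c(1)] Hausdorff_Xdd by (simp add: closedin_Hausdorff_singleton)
    then have "closedin (subtopology Y (H (v i)))
        {z \<in> topspace (subtopology Y (H (v i))). q (v i) z \<in> {?x (v i)}}"
      using q_cont closedin_continuous_map_preimage by blast
    moreover have "{z \<in> topspace (subtopology Y (H (v i))). q (v i) z \<in> {?x (v i)}} = C i"
      using H_subset unfolding C_def by auto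
    ultimately show ?thesis using closed_H closedin_trans_full by metis
  qed
  moreover have "C (Suc i) \<subseteq> C i" for i
  proof (cases "\<exists>n. ?x (v i) = b (v i) (v i @ [n])")
    case True
    then obtain n where n: "?x (v i) = b (v i) (v i @ [n])" by blast
    then have "v (Suc i) = v i @ [n]" using next1 vS by simp
    then show ?thesis using n H_snoc[of "v i" n] unfolding C_def by auto
  next
    case False
    then have "v (Suc i) = v i" using next2 vS by simp
    then show ?thesis unfolding C_def by simp
  qed
  then have "decseq C" by (rule decseq_SucI)
  ultimately have "(\<Inter>i. C i) \<noteq> {}" using compact_space_imp_nest[OF compact_Y] by blast
  then obtain y where y: "\<And>i. y \<in> C i" by blast
  have yY: "y \<in> topspace Y" using y[of 0] H_subset unfolding C_def by blast
  \<comment> \<open>The clause on the path carries the induction. When the coordinate at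
    \<open>t\<close> does not face the child, \<open>coord_edge\<close> makes the coordinate of the
    child face \<open>t\<close>.\<close>
  have "(y \<in> H t \<longrightarrow> (\<exists>i. t = v i)) \<and> proj t y = ?x t" for t
  proof (induction t rule: rev_induct)
    case Nil
    have "proj [] y = ?x []" using y[of 0] by (simp add: C_def v0 proj_def)
    then show ?case using v0 by metis
  next
    case (snoc n t)
    show ?case
    proof (cases "?x t = b t (t @ [n])")
      case True
      then have yt: "y \<in> H (t @ [n])" using in_H_snoc_iff[OF yY] snoc by simp
      then have "y \<in> H t" by (simp add: H_snoc)
      then obtain i where "t = v i" using snoc by blast
      then have i: "t @ [n] = v (Suc i)" using next1[OF True] vS by simp
      then have "proj (t @ [n]) y = ?x (t @ [n])" using y[of "Suc i"] unfolding C_def proj_def by simp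
      then show ?thesis using i by blast
    next
      case False
      then have "y \<notin> H (t @ [n])" using in_H_snoc_iff[OF yY] snoc by simp
      then show ?thesis using coord_edge[OF c(1), of t n] False by (simp add: proj_def)
    qed
  qed
  then show ?thesis using yY by blast
qed

text \<open>\<open>coord\<close> is injective because points with equal coordinates are images of
  the same \<open>y\<close>; the Hausdorff property is then pulled back from the product of the
  extensions.\<close>

lemma Hausdorff_dense_amalgam: "Hausdorff_space (dense_amalgam_of Xdd b)"
proof (rule Hausdorff_space_injective_preimage)
  show "Hausdorff_space (product_topology Xdd UNIV)"
    by (simp add: Hausdorff_space_product_topology Hausdorff_Xdd)
  show "continuous_map (dense_amalgam_of Xdd b) (product_topology Xdd UNIV) coord"
    unfolding dense_amalgam_of_def continuous_map_componentwise_UNIV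
    by (intro allI continuous_map_from_subtopology continuous_map_coord)
  show "inj_on coord (topspace (dense_amalgam_of Xdd b))"
  proof (rule inj_onI)
    fix c c' assume c: "c \<in> topspace (dense_amalgam_of Xdd b)" "c' \<in> topspace (dense_amalgam_of Xdd b)"
      and eq: "coord c = coord c'"
    obtain y where y: "y \<in> topspace Y" "\<And>t. proj t y = coord c t"
      using exists_point_with_coords[of c] c(1) by (auto simp: dense_amalgam_of_def)
    have "to_wedge y = c" "to_wedge y = c'"
      using c y eq by (auto intro!: proj_eq_coord_imp_to_wedge simp: dense_amalgam_of_def)
    then show "c = c'" by simp
  qed
qed

lemma homeomorphic_dense_amalgam: "Y homeomorphic_space dense_amalgam_of Xdd b"
proof -
  have top: "topspace (dense_amalgam_of Xdd b) = topspace (wedge Xdd b) - periph_pts Xdd b"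
    by (auto simp: dense_amalgam_of_def)
  have im: "to_wedge ` topspace Y = topspace (dense_amalgam_of Xdd b)"
  proof
    show "to_wedge ` topspace Y \<subseteq> topspace (dense_amalgam_of Xdd b)"
      using to_wedge_in_wedge to_wedge_not_peripheral unfolding top by blast
    show "topspace (dense_amalgam_of Xdd b) \<subseteq> to_wedge ` topspace Y"
    proof
      fix c assume "c \<in> topspace (dense_amalgam_of Xdd b)"
      then have c: "c \<in> topspace (wedge Xdd b)" "c \<notin> periph_pts Xdd b" unfolding top by auto
      obtain y where "y \<in> topspace Y" "\<And>t. proj t y = coord c t"
        using exists_point_with_coords[OF c] by blast
      then show "c \<in> to_wedge ` topspace Y" using proj_eq_coord_imp_to_wedge[OF c(1)] by blast
    qed
  qed
  have "continuous_map Y (dense_amalgam_of Xdd b) to_wedge"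
    using im continuous_map_to_wedge unfolding top
    unfolding dense_amalgam_of_def by (intro continuous_map_into_subtopology) auto
  then have "homeomorphic_map Y (dense_amalgam_of Xdd b) to_wedge"
    using compact_Y Hausdorff_dense_amalgam im inj_on_to_wedge
    by (intro continuous_imp_homeomorphic_map) auto
  then show ?thesis by (rule homeomorphic_map_imp_homeomorphic_space)
qed

end

section \<open>Recursive decomposition along the tree\<close>

context null_partition begin

lemma tree_decomposition:
  assumes ts: "tree_system (sum_topology X {..<k}) Xdd P b"
  shows "\<exists>H q. amalgam_chart (sum_topology X {..<k}) Xdd P b Y H q"
proof -
  interpret T: peripheral_tree "sum_topology X {..<k}" Xdd P b by standard fact
  obtain E :: "nat \<Rightarrow> 'y set" where E: "range E = {A. clopen_sat A}"
    using countable_clopen_sat clopen_sat_empty uncountable_def by (metis empty_iff mem_Collect_eq)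
  have "countable members" "infinite members"
    unfolding members_def by (fact countable_members infinite_members)+
  then have "countable members" "members \<noteq> {}" by auto
  then obtain \<zeta> :: "nat \<Rightarrow> 'y set" where \<zeta>: "range \<zeta> = members"
    using uncountable_def by metis
  \<comment> \<open>The peripheral points facing children; \<open>D t\<close> drops the one facing
    the parent, so that its peripheral points index exactly the child pieces.\<close>
  define Ch where "Ch t = range (\<lambda>n. b t (t @ [n]))" for t
  define D where "D t = subtopology (Xdd t) (topspace (Xdd t) - (P t - Ch t))" for t
  have P_Ch: "P t - Ch t = {x. t \<noteq> [] \<and> x = b t (butlast t)}" for t
  proof -
    have "nbrs t = range (\<lambda>n. t @ [n]) \<union> {s. t \<noteq> [] \<and> s = butlast t}"
      using tadj_butlast[of t] by (auto simp: nbrs_def elim: tadj_cases)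
    then have "P t = b t ` (range (\<lambda>n. t @ [n]) \<union> {s. t \<noteq> [] \<and> s = butlast t})"
      using T.b_bij[of t] by (simp add: bij_betw_def)
    moreover have "b t (butlast t) \<notin> Ch t" if "t \<noteq> []"
    proof
      assume "b t (butlast t) \<in> Ch t"
      then obtain n where "b t (butlast t) = b t (t @ [n])" by (auto simp: Ch_def)
      then have "butlast t = t @ [n]" by (rule T.b_inj[OF tadj_butlast[OF that] tadj_snoc])
      then have "length (butlast t) = length (t @ [n])" by simp
      then show False by simp
    qed
    ultimately show ?thesis by (auto simp: Ch_def)
  qed
  have Ch_P: "Ch t \<subseteq> P t" for t
    using T.b_in_P[OF tadj_snoc] by (auto simp: Ch_def)
  have "finite (P t - Ch t)" for t
    unfolding P_Ch by (rule finite_subset[of _ "{b t (butlast t)}"]) auto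
  then have pe: "peripheral_extension (sum_topology X {..<k}) (D t) (Ch t)" for t
    unfolding D_def by (rule peripheral_extension_remove_finite[OF T.peripheral_extension Ch_P])
  define good where "good A t q \<longleftrightarrow> continuous_map (subtopology Y A) (D t) q \<and> q ` A = topspace (D t) \<and>
      inj_on q {y \<in> A. q y \<notin> Ch t} \<and>
      (\<forall>p\<in>Ch t. clopen_sat {y \<in> A. q y = p} \<and>
        ({y \<in> A. q y = p} \<subseteq> E (length t) \<or> {y \<in> A. q y = p} \<inter> E (length t) = {})) \<and>
      (\<zeta> (length t) \<in> members \<and> \<zeta> (length t) \<subseteq> A \<longrightarrow> q ` \<zeta> (length t) \<inter> Ch t = {})" for A t q
  define Q where "Q A t = (SOME q. good A t q)" for A t
  have Q: "good A t (Q A t)" if "clopen_sat A" "A \<noteq> {}" for A t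
  proof -
    have "clopen_sat (E (length t))" using E by blast
    then have "\<exists>q. good A t q"
      unfolding good_def by (rule peripheral_quotient[OF pe that])
    then show ?thesis unfolding Q_def by (rule someI_ex)
  qed
  \<comment> \<open>Children are appended at the end of a list, so the recursion runs over the
    reversed vertex.\<close>
  define Hr where "Hr = rec_list (topspace Y)
      (\<lambda>n u A. {y \<in> A. Q A (rev u) y = b (rev u) (rev u @ [n])})"
  define H where "H t = Hr (rev t)" for t
  define q where "q t = Q (H t) t" for t
  have H_Nil: "H [] = topspace Y" by (simp add: H_def Hr_def)
  have H_snoc: "H (t @ [n]) = {y \<in> H t. q t y = b t (t @ [n])}" for t n
    by (simp add: H_def Hr_def q_def)
  have H: "clopen_sat (H t) \<and> H t \<noteq> {}" for t
  proof (induction t rule: rev_induct)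
    case Nil
    obtain Z where "Z \<in> members" using \<zeta> by blast
    then have "topspace Y \<noteq> {}" using member_subset member_nonempty by blast
    then show ?case using clopen_sat_topspace by (simp add: H_Nil)
  next
    case (snoc n t)
    then have g: "good (H t) t (q t)" using Q unfolding q_def by blast
    have p: "b t (t @ [n]) \<in> Ch t" by (simp add: Ch_def)
    then have "b t (t @ [n]) \<in> q t ` H t"
      using g T.b_in_topspace[OF tadj_snoc, of t n] by (auto simp: good_def D_def)
    then have "H (t @ [n]) \<noteq> {}" unfolding H_snoc by auto
    moreover have "clopen_sat (H (t @ [n]))" using g p unfolding H_snoc good_def by blast
    ultimately show ?case by simp
  qed
  have g: "good (H t) t (q t)" for t using Q H unfolding q_def by blast
  have q_inj: "y = z" if "y \<in> H t" "z \<in> H t" "q t y = q t z" "q t y \<notin> Ch t" for y z t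
    using g[of t] that unfolding good_def by (auto dest: inj_onD)
  have separating: "\<exists>t. y \<in> H t \<and> z \<in> H t \<and> q t y \<noteq> q t z"
    if y: "y \<in> topspace Y" and z: "z \<in> topspace Y" and ne: "y \<noteq> z" for y z
  proof (rule ccontr)
    assume "\<not> ?thesis"
    then have same: "\<And>t. y \<in> H t \<Longrightarrow> z \<in> H t \<Longrightarrow> q t y = q t z" by blast
    \<comment> \<open>\<open>q t\<close> identifies distinct points only within a fibre over a child
      point, so points that are never separated descend together forever.\<close>
    have child: "\<exists>m. y \<in> H (t @ [m]) \<and> z \<in> H (t @ [m])" if "y \<in> H t" "z \<in> H t" for t
    proof -
      have "q t y \<in> Ch t" using q_inj[OF that same[OF that]] ne by blast
      then show ?thesis using that same[OF that] by (auto simp: H_snoc Ch_def)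
    qed
    have deep: "\<exists>t. length t = n \<and> y \<in> H t \<and> z \<in> H t" for n
    proof (induction n)
      case 0
      then show ?case using y z H_Nil by auto
    next
      case (Suc n)
      then show ?case using child by (metis length_append_singleton)
    qed
    \<comment> \<open>A separating clopen saturated set is some \<open>E n\<close>, but the common
      child piece below depth \<open>n\<close> lies on one side of \<open>E n\<close>.\<close>
    have "z \<in> blk y"
    proof (rule ccontr)
      assume "z \<notin> blk y"
      then obtain C where C: "clopen_sat C" "y \<in> C" "z \<notin> C"
        using clopen_sat_separates[OF y z] by blast
      then obtain n where n: "C = E n" using E by blast
      obtain t where t: "length t = n" "y \<in> H t" "z \<in> H t" using deep by blast
      obtain m where m: "y \<in> H (t @ [m])" "z \<in> H (t @ [m])" using child[OF t(2,3)] by blast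
      have "b t (t @ [m]) \<in> Ch t" by (simp add: Ch_def)
      then have "H (t @ [m]) \<subseteq> E n \<or> H (t @ [m]) \<inter> E n = {}"
        using g[of t] t(1) unfolding good_def H_snoc by blast
      then show False using C m n by blast
    qed
    \<comment> \<open>A common member is some \<open>\<zeta> n\<close>, and at depth
      \<open>n\<close> the map \<open>q t\<close> keeps it off the child points, where it is
      injective.\<close>
    then obtain Z where Z: "Z \<in> members" "y \<in> Z" "z \<in> Z" using ne by (auto simp: blk_def)
    obtain n where n: "Z = \<zeta> n" using Z(1) \<zeta> by blast
    obtain t where t: "length t = n" "y \<in> H t" "z \<in> H t" using deep by blast
    have "Z \<subseteq> H t" using H Z(1,2) t(2) clopen_satD by blast
    then have "q t ` Z \<inter> Ch t = {}" using g[of t] t(1) n Z(1) unfolding good_def by blast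
    then have "q t y \<notin> Ch t" using Z(2) by blast
    then show False using q_inj[OF t(2,3) same[OF t(2,3)]] ne by blast
  qed
  have "amalgam_chart (sum_topology X {..<k}) Xdd P b Y H q"
  proof unfold_locales
    show "compact_space Y" by (rule compact_Y)
    show "openin Y (H t)" "closedin Y (H t)" for t using H[of t] by (auto simp: clopen_sat_def)
    show "continuous_map (subtopology Y (H t)) (Xdd t) (q t)" for t
      using g[of t] by (simp add: good_def D_def continuous_map_in_subtopology)
    show "q t ` H t = topspace (Xdd t) - {x. t \<noteq> [] \<and> x = b t (butlast t)}" for t
      using g[of t] P_Ch[of t] by (auto simp: good_def D_def)
  qed (fact H_Nil H_snoc separating)+
  then show ?thesis by blast
qed

end

theorem theorem0p2:
  fixes X :: "nat \<Rightarrow> 'a topology" and k :: nat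
    and Y :: "'y topology" and YF :: "nat \<Rightarrow> 'y set set"
    and Xdd :: "nat list \<Rightarrow> 'b topology" and P :: "nat list \<Rightarrow> 'b set"
    and b :: "nat list \<Rightarrow> nat list \<Rightarrow> 'b"
  assumes "k \<ge> 1"
    and "\<forall>i<k. compact_space (X i) \<and> metrizable_space (X i) \<and> topspace (X i) \<noteq> {}"
    and "compact_space Y" and "metrizable_space Y"
    and "\<forall>i<k. \<forall>j<k. i \<noteq> j \<longrightarrow> YF i \<inter> YF j = {}"
    and "countable (\<Union>i<k. YF i)" and "infinite (\<Union>i<k. YF i)"
    and a1: "\<forall>Z\<in>(\<Union>i<k. YF i). \<forall>Z'\<in>(\<Union>i<k. YF i). Z \<noteq> Z' \<longrightarrow> Z \<inter> Z' = {}"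
    and a1': "\<forall>i<k. \<forall>Z\<in>YF i. Z \<subseteq> topspace Y \<and> subtopology Y Z homeomorphic_space X i"
    and a2: "\<forall>d. Metric_space (topspace Y) d \<and> Metric_space.mtopology (topspace Y) d = Y \<longrightarrow>
               (\<forall>\<epsilon>>0. finite {Z \<in> (\<Union>i<k. YF i). Sup {d x y |x y. x \<in> Z \<and> y \<in> Z} \<ge> \<epsilon>})"
    and a3: "\<forall>Z\<in>(\<Union>i<k. YF i). Y closure_of (topspace Y - Z) = topspace Y"
    and a4: "\<forall>i<k. Y closure_of (\<Union>(YF i)) = topspace Y"
    and a5: "\<forall>x\<in>topspace Y. \<forall>y\<in>topspace Y. x \<noteq> y \<and> \<not> (\<exists>Z\<in>(\<Union>i<k. YF i). x \<in> Z \<and> y \<in> Z) \<longrightarrow>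
               (\<exists>H. openin Y H \<and> closedin Y H \<and> (\<forall>Z\<in>(\<Union>i<k. YF i). Z \<subseteq> H \<or> Z \<inter> H = {})
                    \<and> x \<in> H \<and> y \<notin> H)"
    and "tree_system (sum_topology X {..<k}) Xdd P b"
  shows "Y homeomorphic_space dense_amalgam_of Xdd b"
proof -
  interpret null_partition X k Y YF
    by (rule null_partition.intro) fact+
  obtain H q where "amalgam_chart (sum_topology X {..<k}) Xdd P b Y H q"
    using tree_decomposition[OF assms(14)] by blast
  then show ?thesis by (rule amalgam_chart.homeomorphic_dense_amalgam)
qed

end
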